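(* \textsc{Blue Leader Stackelberg Equilibrium} admits a bilevel optimization formulation with $\mathcal{O}(n^2+n\cdot k)$ binary variables, $\mathcal{O}(n)$ integer variables, and $\mathcal{O}(n^2\cdot k)$ constraints, where $n$ is the number of targets and $k$ is the number of sensors.
   Context: An Escape Sensing Game (ESG) consists of: a finite set of targets $T=\{t_1,\dots,t_n\}$, each $t_i$ with a value $v_i\in\mathbb{R}^+$; a finite set of sensors $S=\{s_1,\dots,s_k\}$; a recharging time $\tau\in\mathbb{N}\cup\{\infty\}$ common to all sensors; and a sensing matrix $D\in\{0,1\}^{n\times k}$, where $D_{i,j}=1$ means that sensor $s_j$ is capable of sensing target $t_i$. A target ordering is a bijection $\sigma:T\to[n]$. A sensing plan is a map $\psi:S\to 2^T$ with $\psi(s)\cap\psi(s')=\emptyset$ for all $s\neq s'\in S$. The plan $\psi$ is valid with respect to $\sigma$ if (i) for each $s_j\in S$ and $t_i\in\psi(s_j)$ we have $D_{i,j}=1$, and (ii) for each $s\in S$ and all distinct $t,t'\in\psi(s)$ we have $|\sigma(t)-\sigma(t')|>\tau$ (so if $\tau=\infty$ each sensor senses at most one target). The value of not-sensed targets is $v(\psi)=\sum_{t_i\in T\setminus\bigcup_{s\in S}\psi(s)}v_i$. \textsc{Blue Leader Stackelberg Equilibrium}: given an ESG, solve $\max_{\sigma}\min_{\psi:\ \psi\text{ valid w.r.t. }\sigma}v(\psi)$, where $\sigma$ ranges over all target orderings. A (linear, integer) bilevel optimization program has two levels, each controlling its own binary/integer variables: the inner level sets its variables to minimize a linear objective subject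 to linear constraints that may also involve the outer-level variables, while the outer level sets its variables, subject to linear constraints, to maximize the objective, given that the inner level responds optimally. That the problem admits a bilevel formulation of a given size means: from every instance one can construct in polynomial time such a program of that size in which the feasible outer-level assignments encode target orderings $\sigma$ (every ordering being encoded), the feasible inner-level assignments encode the sensing plans valid with respect to the encoded $\sigma$, and the objective equals $v(\psi)$; so its optimal solutions encode the solutions of the instance. *)

theory Defs
  imports
    Complex_Main
    "HOL-Library.FuncSet"
    "HOL-Library.Disjoint_Sets"
    "HOL-Library.Extended_Nat"
    "HOL-Computational_Algebra.Polynomial"
begin

section \<open>Escape sensing games\<close>

text \<open>
  The targets \<open>t\<^sub>1, \<dots>, t\<^sub>n\<close> and the sensors \<open>s\<^sub>1, \<dots>, s\<^sub>k\<close> are represented by their indices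
  in \<open>{1..n}\<close> and \<open>{1..k}\<close>. The fields \<open>target_val\<close> and \<open>senses\<close> only matter on these indices.
\<close>

record esg =
  num_targets :: nat
  num_sensors :: nat
  target_val :: "nat \<Rightarrow> real"
  recharge :: enat
  senses :: "nat \<Rightarrow> nat \<Rightarrow> bool"

definition targets :: "esg \<Rightarrow> nat set" where
  "targets G = {1..num_targets G}"

definition sensors :: "esg \<Rightarrow> nat set" where
  "sensors G = {1..num_sensors G}"

definition is_esg :: "esg \<Rightarrow> bool" where
  "is_esg G \<longleftrightarrow> (\<forall>i\<in>targets G. 0 < target_val G i)"

text \<open>Orderings and plans are extensional functions, so that distinct functions in these sets
  differ on a target or on a sensor, respectively.\<close>

definition orderings :: "esg \<Rightarrow> (nat \<Rightarrow> nat) set" where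
  "orderings G =
    {\<sigma> \<in> extensional (targets G). bij_betw \<sigma> (targets G) {1..num_targets G}}"

definition plans :: "esg \<Rightarrow> (nat \<Rightarrow> nat set) set" where
  "plans G =
    {\<psi> \<in> sensors G \<rightarrow>\<^sub>E Pow (targets G). disjoint_family_on \<psi> (sensors G)}"

definition valid_plans :: "esg \<Rightarrow> (nat \<Rightarrow> nat) \<Rightarrow> (nat \<Rightarrow> nat set) set" where
  "valid_plans G \<sigma> =
    {\<psi> \<in> plans G.
      (\<forall>j\<in>sensors G. \<forall>i\<in>\<psi> j. senses G i j) \<and>
      (\<forall>j\<in>sensors G. \<forall>i\<in>\<psi> j. \<forall>i'\<in>\<psi> j. i \<noteq> i' \<longrightarrow>
         enat (nat \<bar>int (\<sigma> i) - int (\<sigma> i')\<bar>) > recharge G)}"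

definition unsensed_val :: "esg \<Rightarrow> (nat \<Rightarrow> nat set) \<Rightarrow> real" where
  "unsensed_val G \<psi> = (\<Sum>i \<in> targets G - (\<Union>j\<in>sensors G. \<psi> j). target_val G i)"

definition ordering_val :: "esg \<Rightarrow> (nat \<Rightarrow> nat) \<Rightarrow> real" where
  "ordering_val G \<sigma> = (MIN \<psi>\<in>valid_plans G \<sigma>. unsensed_val G \<psi>)"

definition blue_leader_val :: "esg \<Rightarrow> real" where
  "blue_leader_val G = (MAX \<sigma>\<in>orderings G. ordering_val G \<sigma>)"

definition blue_leader_equilibrium :: "esg \<Rightarrow> (nat \<Rightarrow> nat) \<Rightarrow> (nat \<Rightarrow> nat set) \<Rightarrow> bool" where
  "blue_leader_equilibrium G \<sigma> \<psi> \<longleftrightarrow>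
    \<sigma> \<in> orderings G \<and> ordering_val G \<sigma> = blue_leader_val G \<and>
    \<psi> \<in> valid_plans G \<sigma> \<and> unsensed_val G \<psi> = ordering_val G \<sigma>"


section \<open>Linear integer bilevel programs\<close>

datatype var = OuterBin nat | OuterInt nat | InnerBin nat | InnerInt nat

type_synonym lin = "(real \<times> var) list"

text \<open>A pair \<open>(l, b)\<close> stands for the constraint \<open>l \<le> b\<close>; an equation is two such constraints.\<close>

type_synonym lin_constraint = "lin \<times> real"

record bilevel =
  outer_bins :: nat
  outer_ints :: nat
  inner_bins :: nat
  inner_ints :: nat
  objective :: lin
  outer_constraints :: "lin_constraint list"
  inner_constraints :: "lin_constraint list"

definition num_binary_vars :: "bilevel \<Rightarrow> nat" where
  "num_binary_vars P = outer_bins P + inner_bins P"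

definition num_integer_vars :: "bilevel \<Rightarrow> nat" where
  "num_integer_vars P = outer_ints P + inner_ints P"

definition num_constraints :: "bilevel \<Rightarrow> nat" where
  "num_constraints P = length (outer_constraints P) + length (inner_constraints P)"

definition outer_var_list :: "bilevel \<Rightarrow> var list" where
  "outer_var_list P = map OuterBin [0..<outer_bins P] @ map OuterInt [0..<outer_ints P]"

definition inner_var_list :: "bilevel \<Rightarrow> var list" where
  "inner_var_list P = map InnerBin [0..<inner_bins P] @ map InnerInt [0..<inner_ints P]"

abbreviation outer_vars :: "bilevel \<Rightarrow> var set" where
  "outer_vars P \<equiv> set (outer_var_list P)"

abbreviation inner_vars :: "bilevel \<Rightarrow> var set" where
  "inner_vars P \<equiv> set (inner_var_list P)"

definition lin_vars :: "lin \<Rightarrow> var set" where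
  "lin_vars l = snd ` set l"

definition is_bilevel :: "bilevel \<Rightarrow> bool" where
  "is_bilevel P \<longleftrightarrow>
    lin_vars (objective P) \<subseteq> outer_vars P \<union> inner_vars P \<and>
    (\<forall>(l, b) \<in> set (outer_constraints P). lin_vars l \<subseteq> outer_vars P) \<and>
    (\<forall>(l, b) \<in> set (inner_constraints P). lin_vars l \<subseteq> outer_vars P \<union> inner_vars P)"

fun var_range :: "var \<Rightarrow> int set" where
  "var_range (OuterBin i) = {0, 1}"
| "var_range (OuterInt i) = UNIV"
| "var_range (InnerBin i) = {0, 1}"
| "var_range (InnerInt i) = UNIV"

definition lin_val :: "(var \<Rightarrow> int) \<Rightarrow> lin \<Rightarrow> real" where
  "lin_val a l = (\<Sum>(c, v)\<leftarrow>l. c * real_of_int (a v))"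

definition satisfies :: "(var \<Rightarrow> int) \<Rightarrow> lin_constraint \<Rightarrow> bool" where
  "satisfies a c \<longleftrightarrow> lin_val a (fst c) \<le> snd c"

definition joint :: "bilevel \<Rightarrow> (var \<Rightarrow> int) \<Rightarrow> (var \<Rightarrow> int) \<Rightarrow> var \<Rightarrow> int" where
  "joint P x y = override_on y x (outer_vars P)"

definition outer_feasible :: "bilevel \<Rightarrow> (var \<Rightarrow> int) set" where
  "outer_feasible P =
    {x \<in> Pi\<^sub>E (outer_vars P) var_range. \<forall>c \<in> set (outer_constraints P). satisfies x c}"

definition inner_feasible :: "bilevel \<Rightarrow> (var \<Rightarrow> int) \<Rightarrow> (var \<Rightarrow> int) set" where
  "inner_feasible P x =
    {y \<in> Pi\<^sub>E (inner_vars P) var_range.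
      \<forall>c \<in> set (inner_constraints P). satisfies (joint P x y) c}"

definition objective_val :: "bilevel \<Rightarrow> (var \<Rightarrow> int) \<Rightarrow> (var \<Rightarrow> int) \<Rightarrow> real" where
  "objective_val P x y = lin_val (joint P x y) (objective P)"

definition bilevel_feasible :: "bilevel \<Rightarrow> (var \<Rightarrow> int) \<Rightarrow> (var \<Rightarrow> int) \<Rightarrow> bool" where
  "bilevel_feasible P x y \<longleftrightarrow>
    x \<in> outer_feasible P \<and> is_arg_min (objective_val P x) (\<lambda>y'. y' \<in> inner_feasible P x) y"

text \<open>Both levels share one objective, so all inner optima for a fixed outer assignment have the
  same objective value, and optimistic and pessimistic bilevel optimality coincide.\<close>

definition bilevel_optimal :: "bilevel \<Rightarrow> (var \<Rightarrow> int) \<Rightarrow> (var \<Rightarrow> int) \<Rightarrow> bool" where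
  "bilevel_optimal P x y \<longleftrightarrow>
    bilevel_feasible P x y \<and>
    (\<forall>x' y'. bilevel_feasible P x' y' \<longrightarrow> objective_val P x' y' \<le> objective_val P x y)"


section \<open>Polynomial time\<close>

text \<open>
  Target values are real numbers, so running time is measured on a random access machine with
  real-valued cells: every instruction has unit cost, and the size of an input is the number of
  its real entries. Arithmetic is restricted to integer constants, addition and subtraction.
  Without multiplication and rounding, the numbers produced in polynomially many steps from
  rational inputs have polynomially many bits, so that on such inputs this is no more powerful
  than polynomial time on Turing machines.

  The input is read-only, the output is append-only, and reading a cell whose address is not a
  natural number (or is beyond the end of the input) yields 0.
\<close>

datatype expr = Const int | Cell expr | Input expr | Plus expr expr | Minus expr expr

fun expr_val :: "real list \<Rightarrow> (nat \<Rightarrow> real) \<Rightarrow> expr \<Rightarrow> real" where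
  "expr_val inp m (Const c) = real_of_int c"
| "expr_val inp m (Cell e) =
    (let a = expr_val inp m e in if a \<in> \<nat> then m (nat \<lfloor>a\<rfloor>) else 0)"
| "expr_val inp m (Input e) =
    (let a = expr_val inp m e
     in if a \<in> \<nat> \<and> nat \<lfloor>a\<rfloor> < length inp then inp ! nat \<lfloor>a\<rfloor> else 0)"
| "expr_val inp m (Plus e f) = expr_val inp m e + expr_val inp m f"
| "expr_val inp m (Minus e f) = expr_val inp m e - expr_val inp m f"

definition store :: "(nat \<Rightarrow> real) \<Rightarrow> real \<Rightarrow> real \<Rightarrow> nat \<Rightarrow> real" where
  "store m a r = (if a \<in> \<nat> then m(nat \<lfloor>a\<rfloor> := r) else m)"

text \<open>The tests of \<open>IfLe\<close> and \<open>WhileLe\<close> ask whether the first expression is at most the second.\<close>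

datatype program =
    Store expr expr
  | Emit expr
  | Seq program program
  | IfLe expr expr program program
  | WhileLe expr expr program

text \<open>\<open>run inp p (m, out) t (m', out')\<close>: started with memory \<open>m\<close> and output \<open>out\<close>, the program
  \<open>p\<close> halts after \<open>t\<close> steps with memory \<open>m'\<close> and output \<open>out'\<close>.\<close>

inductive run ::
  "real list \<Rightarrow> program \<Rightarrow> (nat \<Rightarrow> real) \<times> real list \<Rightarrow> nat \<Rightarrow> (nat \<Rightarrow> real) \<times> real list \<Rightarrow> bool"
  for inp where
  Store: "run inp (Store e f) (m, out) 1 (store m (expr_val inp m e) (expr_val inp m f), out)"
| Emit: "run inp (Emit e) (m, out) 1 (m, out @ [expr_val inp m e])"
| Seq: "run inp p s t s' \<Longrightarrow> run inp q s' t' s'' \<Longrightarrow> run inp (Seq p q) s (t + t') s''"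
| IfTrue: "expr_val inp m e \<le> expr_val inp m f \<Longrightarrow> run inp p (m, out) t s' \<Longrightarrow>
    run inp (IfLe e f p q) (m, out) (Suc t) s'"
| IfFalse: "\<not> expr_val inp m e \<le> expr_val inp m f \<Longrightarrow> run inp q (m, out) t s' \<Longrightarrow>
    run inp (IfLe e f p q) (m, out) (Suc t) s'"
| WhileFalse: "\<not> expr_val inp m e \<le> expr_val inp m f \<Longrightarrow>
    run inp (WhileLe e f p) (m, out) 1 (m, out)"
| WhileTrue: "expr_val inp m e \<le> expr_val inp m f \<Longrightarrow> run inp p (m, out) t s' \<Longrightarrow>
    run inp (WhileLe e f p) s' t' s'' \<Longrightarrow>
    run inp (WhileLe e f p) (m, out) (Suc (t + t')) s''"

definition poly_time_on ::
  "'a set \<Rightarrow> ('a \<Rightarrow> real list) \<Rightarrow> ('a \<Rightarrow> real list) \<Rightarrow> bool" where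
  "poly_time_on X enc f \<longleftrightarrow>
    (\<exists>(p :: program) (q :: nat poly). \<forall>x\<in>X. \<exists>t m.
       run (enc x) p (\<lambda>_. 0, []) t (m, f x) \<and> t \<le> poly q (length (enc x)))"


subsection \<open>Encodings as lists of real numbers\<close>

definition encode_esg :: "esg \<Rightarrow> real list" where
  "encode_esg G =
    [real (num_targets G), real (num_sensors G)] @
    (case recharge G of enat d \<Rightarrow> [1, real d] | \<infinity> \<Rightarrow> [0, 0]) @
    [target_val G i. i \<leftarrow> [1..<Suc (num_targets G)]] @
    [of_bool (senses G i j). i \<leftarrow> [1..<Suc (num_targets G)], j \<leftarrow> [1..<Suc (num_sensors G)]]"

text \<open>Lists are made self-delimiting by putting 1 in front of each element and 0 at the end.\<close>

definition encode_list :: "('a \<Rightarrow> real list) \<Rightarrow> 'a list \<Rightarrow> real list" where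
  "encode_list enc xs = concat (map (\<lambda>x. 1 # enc x) xs) @ [0]"

fun encode_var :: "var \<Rightarrow> real list" where
  "encode_var (OuterBin i) = [0, real i]"
| "encode_var (OuterInt i) = [1, real i]"
| "encode_var (InnerBin i) = [2, real i]"
| "encode_var (InnerInt i) = [3, real i]"

definition encode_lin :: "lin \<Rightarrow> real list" where
  "encode_lin = encode_list (\<lambda>(c, v). c # encode_var v)"

definition encode_constraint :: "lin_constraint \<Rightarrow> real list" where
  "encode_constraint = (\<lambda>(l, b). encode_lin l @ [b])"

definition encode_bilevel :: "bilevel \<Rightarrow> real list" where
  "encode_bilevel P =
    [real (outer_bins P), real (outer_ints P), real (inner_bins P), real (inner_ints P)] @
    encode_lin (objective P) @
    encode_list encode_constraint (outer_constraints P) @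
    encode_list encode_constraint (inner_constraints P)"

definition encode_assignment :: "var list \<Rightarrow> (var \<Rightarrow> int) \<Rightarrow> real list" where
  "encode_assignment vs a = map (\<lambda>v. real_of_int (a v)) vs"

definition encode_ordering :: "esg \<Rightarrow> (nat \<Rightarrow> nat) \<Rightarrow> real list" where
  "encode_ordering G \<sigma> = [real (\<sigma> i). i \<leftarrow> [1..<Suc (num_targets G)]]"

definition encode_plan :: "esg \<Rightarrow> (nat \<Rightarrow> nat set) \<Rightarrow> real list" where
  "encode_plan G \<psi> =
    [of_bool (i \<in> \<psi> j). i \<leftarrow> [1..<Suc (num_targets G)], j \<leftarrow> [1..<Suc (num_sensors G)]]"


section \<open>Bilevel formulations\<close>

text \<open>
  \<open>dec_ord\<close> and \<open>dec_plan\<close> map an assignment to the ordering or plan that it encodes. Several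
  assignments may encode the same object.
\<close>

definition bilevel_formulation ::
  "esg \<Rightarrow> bilevel \<Rightarrow> ((var \<Rightarrow> int) \<Rightarrow> nat \<Rightarrow> nat) \<Rightarrow> ((var \<Rightarrow> int) \<Rightarrow> nat \<Rightarrow> nat set) \<Rightarrow> bool" where
  "bilevel_formulation G P dec_ord dec_plan \<longleftrightarrow>
    is_bilevel P \<and>
    dec_ord ` outer_feasible P = orderings G \<and>
    (\<forall>x \<in> outer_feasible P.
       dec_plan ` inner_feasible P x = valid_plans G (dec_ord x) \<and>
       (\<forall>y \<in> inner_feasible P x. objective_val P x y = unsensed_val G (dec_plan y))) \<and>
    {(dec_ord x, dec_plan y) | x y. bilevel_optimal P x y} =
      {(\<sigma>, \<psi>). blue_leader_equilibrium G \<sigma> \<psi>}"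

definition poly_time_formulation ::
  "(esg \<Rightarrow> bilevel) \<Rightarrow> (esg \<Rightarrow> (var \<Rightarrow> int) \<Rightarrow> nat \<Rightarrow> nat) \<Rightarrow>
    (esg \<Rightarrow> (var \<Rightarrow> int) \<Rightarrow> nat \<Rightarrow> nat set) \<Rightarrow> bool" where
  "poly_time_formulation P dec_ord dec_plan \<longleftrightarrow>
    poly_time_on {G. is_esg G} encode_esg (\<lambda>G. encode_bilevel (P G)) \<and>
    poly_time_on {(G, x). is_esg G \<and> x \<in> outer_feasible (P G)}
      (\<lambda>(G, x). encode_esg G @ encode_assignment (outer_var_list (P G)) x)
      (\<lambda>(G, x). encode_ordering G (dec_ord G x)) \<and>
    poly_time_on {(G, y). is_esg G \<and> (\<exists>x \<in> outer_feasible (P G). y \<in> inner_feasible (P G) x)}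
      (\<lambda>(G, y). encode_esg G @ encode_assignment (inner_var_list (P G)) y)
      (\<lambda>(G, y). encode_plan G (dec_plan G y))"

end

theory Submission imports Defs begin

text \<open>
  The outer level chooses a permutation matrix \<open>x\<close>. The inner level chooses the incidence matrix \<open>y\<close>
  of targets and sensors, the indicators \<open>u\<close> of unsensed targets, and reservations \<open>z\<close> of sensors at
  positions. If sensor \<open>j\<close> senses target \<open>i\<close> and \<open>i\<close> is at position \<open>p\<close>, then \<open>z\<close> must reserve \<open>j\<close>
  at \<open>p\<close>; the recharging condition then says that every window of \<open>\<tau> + 1\<close> consecutive positions
  contains at most one reservation of \<open>j\<close>. This needs \<open>n\<^sup>2 k\<close> linking constraints, but no products
  of variables, and no integer variables at all.
\<close>

section \<open>Correctness of the formulation\<close>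

text \<open>Stated target by target, the recharging condition compares two targets at two positions,
  and on a permutation matrix this naively costs far more than n^2 k constraints. Moving from
  targets to positions removes the comparison: positions are pairwise farther apart than the
  recharging time exactly if no window holds two of them. Reservations are forced in one direction
  only, so \<open>z\<close> may contain more than the plan requires; this can only tighten the
  windows, and decoding ignores \<open>z\<close>. Soundness therefore covers every feasible
  \<open>z\<close>, while completeness uses the least one. The objective has to agree at all
  feasible inner points, not just at optimal ones, which is why \<open>u\<close> is fixed by an
  equation. For polynomial time the obstacle is that the machine cannot multiply, so flat indices of
  matrix entries are built by repeated addition; output and running time of the resulting nested
  loops are proved together in a small program calculus.\<close>

lemma binary_sum_eq_one:
  fixes f :: "nat \<Rightarrow> int"
  assumes "\<And>p. p < n \<Longrightarrow> f p \<in> {0, 1}" and "(\<Sum>p<n. f p) = 1"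
  obtains s where "s < n" "\<And>p. p < n \<Longrightarrow> f p = of_bool (p = s)"
proof -
  have "(\<Sum>p<n. f p) = (\<Sum>p<n. of_bool (f p = 1))"
    using assms(1) by (intro sum.cong) auto
  also have "\<dots> = int (card {p \<in> {..<n}. f p = 1})"
    by (simp add: sum_of_bool_eq Int_def)
  finally have "card {p \<in> {..<n}. f p = 1} = 1" using assms(2) by simp
  then obtain s where s: "{p \<in> {..<n}. f p = 1} = {s}" by (auto simp: card_1_singleton_iff)
  show thesis
  proof
    show "s < n" using s by auto
    show "f p = of_bool (p = s)" if "p < n" for p
      using s assms(1)[OF that] that by (cases "p = s") auto
  qed
qed

lemma binary_sum_le_oneD:
  fixes f :: "nat \<Rightarrow> int"
  assumes "\<And>p. p < n \<Longrightarrow> f p \<in> {0, 1}" "(\<Sum>p<n. f p) \<le> 1" "a < n" "b < n" "f a = 1" "f b = 1"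
  shows "a = b"
proof (rule ccontr)
  assume "a \<noteq> b"
  then have "(\<Sum>p\<in>{a, b}. f p) = 2" using assms by simp
  moreover have "(\<Sum>p\<in>{a, b}. f p) \<le> (\<Sum>p<n. f p)"
    using assms(1,3,4) by (intro sum_mono2) fastforce+
  ultimately show False using assms(2) by simp
qed

lemma binary_sum_le_oneI:
  fixes f :: "nat \<Rightarrow> int"
  assumes "\<And>p. p < n \<Longrightarrow> f p \<in> {0, 1}" 
    "\<And>a b. a < n \<Longrightarrow> b < n \<Longrightarrow> f a = 1 \<Longrightarrow> f b = 1 \<Longrightarrow> a = b"
  shows "(\<Sum>p<n. f p) \<le> 1"
proof (cases "\<exists>a<n. f a = 1")
  case True
  then obtain a where a: "a < n" "f a = 1" by blast
  have "f p = of_bool (p = a)" if "p < n" for p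
    using assms(1)[OF that] assms(2)[OF that a(1)] a that by (cases "p = a") auto
  then have "(\<Sum>p<n. f p) = (\<Sum>p<n. of_bool (p = a))" by (intro sum.cong) auto
  also have "\<dots> = 1" using a by (simp add: of_bool_def)
  finally show ?thesis by simp
next
  case False
  then have "(\<Sum>p<n. f p) = 0" using assms(1) by (intro sum.neutral) fastforce
  then show ?thesis by simp
qed

section \<open>Flat matrix indices and values of linear forms\<close>

lemma flat_index_less: "i < n \<Longrightarrow> j < k \<Longrightarrow> i * k + j < n * (k::nat)"
  by (metis Suc_leI add.commute add_less_mono1 dual_order.strict_trans1 mult_Suc mult_le_mono1)

lemma nth_concat_map_upt:
  "i < n \<Longrightarrow> j < k \<Longrightarrow> concat (map (\<lambda>i. map (f i) [0..<k]) [0..<n]) ! (i * k + j) = f i j"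
proof (induction n)
  case (Suc n)
  have len: "length (concat (map (\<lambda>i. map (f i) [0..<k]) [0..<n])) = n * k"
    by (simp add: length_concat o_def sum_list_triv)
  show ?case
  proof (cases "i = n")
    case True
    then show ?thesis using Suc(3) len by (simp add: nth_append)
  next
    case False
    then have "i < n" using Suc(2) by simp
    then show ?thesis
      using Suc(1)[OF _ Suc(3)] flat_index_less[OF _ Suc(3), of i n] len by (simp add: nth_append)
  qed
qed simp

lemma lin_val_map:
  "lin_val a (map (\<lambda>p. (c p, v p)) [0..<n]) = (\<Sum>p<n. c p * real_of_int (a (v p)))"
  by (simp add: lin_val_def o_def interv_sum_list_conv_sum_set_nat atLeast0LessThan)

lemma lin_val_Nil [simp]: "lin_val a [] = 0"
  by (simp add: lin_val_def)

lemma lin_val_Cons [simp]: "lin_val a ((c, v) # l) = c * real_of_int (a v) + lin_val a l"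
  by (simp add: lin_val_def)

lemma lin_vars_Nil [simp]: "lin_vars [] = {}"
  and lin_vars_Cons [simp]: "lin_vars (t # l) = insert (snd t) (lin_vars l)"
  and lin_vars_map: "lin_vars (map f is) = (snd \<circ> f) ` set is"
  by (auto simp: lin_vars_def)

lemma joint_outer: "v \<in> outer_vars P \<Longrightarrow> joint P x y v = x v"
  and joint_inner: "v \<notin> outer_vars P \<Longrightarrow> joint P x y v = y v"
  by (simp_all add: joint_def)

section \<open>The bilevel program of a game\<close>

context fixes G :: esg begin

private abbreviation (input) "n \<equiv> num_targets G"
private abbreviation (input) "k \<equiv> num_sensors G"

text \<open>With targets, positions and sensors counted from 0: \<open>x_var i p\<close> says that target \<open>i\<close> is at
  position \<open>p\<close>, \<open>y_var i j\<close> that sensor \<open>j\<close> senses target \<open>i\<close>, \<open>z_var p j\<close> that sensor \<open>j\<close> is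
  reserved at position \<open>p\<close>, and \<open>u_var i\<close> that target \<open>i\<close> is not sensed.\<close>

definition x_var :: "nat \<Rightarrow> nat \<Rightarrow> var" where "x_var i p = OuterBin (i * n + p)"
definition y_var :: "nat \<Rightarrow> nat \<Rightarrow> var" where "y_var i j = InnerBin (i * k + j)"
definition z_var :: "nat \<Rightarrow> nat \<Rightarrow> var" where "z_var p j = InnerBin ((n + p) * k + j)"
definition u_var :: "nat \<Rightarrow> var" where "u_var i = InnerBin (2 * (n * k) + i)"

text \<open>No two positions differ by \<open>n\<close> or more, so \<open>n\<close> can stand for an infinite recharging time.\<close>

definition window :: nat where
  "window = (case recharge G of enat d \<Rightarrow> d | \<infinity> \<Rightarrow> n)"

text \<open>Row sums equal to 1, written as two inequalities, make the matrix a function. Column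
  sums are only bounded by 1: this is injectivity, and on a finite set it already gives a
  bijection.\<close>

definition order_constraints :: "nat \<Rightarrow> lin_constraint list" where
  "order_constraints i =
    [(map (\<lambda>p. (1, x_var i p)) [0..<n], 1),
     (map (\<lambda>p. (-1, x_var i p)) [0..<n], -1),
     (map (\<lambda>p. (1, x_var p i)) [0..<n], 1)]"

text \<open>Since \<open>u\<close> is nonnegative, the equation makes the sets of different sensors
  disjoint. It also determines \<open>u\<close>, so that the objective is the unsensed value at
  every feasible point rather than only at a minimum.\<close>

definition cover_constraints :: "nat \<Rightarrow> lin_constraint list" where
  "cover_constraints i =
    [((1, u_var i) # map (\<lambda>j. (1, y_var i j)) [0..<k], 1),
     ((-1, u_var i) # map (\<lambda>j. (-1, y_var i j)) [0..<k], -1)]"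

definition sense_constraint :: "nat \<Rightarrow> nat \<Rightarrow> lin_constraint" where
  "sense_constraint i j = ([(1, y_var i j)], of_bool (senses G (Suc i) (Suc j)))"

text \<open>A linearised implication: on 0/1 values it bites only if \<open>y\<close> and
  \<open>x\<close> are both 1, and then it forces \<open>z\<close>.\<close>

definition link_constraint :: "nat \<Rightarrow> nat \<Rightarrow> nat \<Rightarrow> lin_constraint" where
  "link_constraint i j p = ([(1, y_var i j), (1, x_var i p), (-1, z_var p j)], 1)"

text \<open>Coefficients outside the window are 0 instead of absent, so every window has
  \<open>n\<close> terms, including those that reach past the last position. The nested conditionals
  mirror those of \<open>window_program\<close>.\<close>

definition window_constraint :: "nat \<Rightarrow> nat \<Rightarrow> lin_constraint" where
  "window_constraint p j =
    (map (\<lambda>q. (if p \<le> q then if q \<le> p + window then 1 else 0 else 0, z_var q j)) [0..<n], 1)"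

text \<open>Each \<open>i\<close> plays two parts: a target in the cover, sensing and linking
  constraints, and the first position of a window. The nesting is that of the loops that later emit
  the constraints.\<close>

definition formulation :: bilevel where
  "formulation =
    \<lparr>outer_bins = n * n, outer_ints = 0, inner_bins = 2 * (n * k) + n, inner_ints = 0,
     objective = map (\<lambda>i. (target_val G (Suc i), u_var i)) [0..<n],
     outer_constraints = concat (map order_constraints [0..<n]),
     inner_constraints = concat (map (\<lambda>i. cover_constraints i @
       concat (map (\<lambda>j. sense_constraint i j # map (link_constraint i j) [0..<n] @
         [window_constraint i j]) [0..<k])) [0..<n])\<rparr>"

text \<open>A row of a feasible matrix has a single 1, and the weighted sum reads off its column.
  Both shifts by one pass between counting from 0 and counting from 1.\<close>

definition decode_ordering :: "(var \<Rightarrow> int) \<Rightarrow> nat \<Rightarrow> nat" where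
  "decode_ordering x = (\<lambda>i\<in>targets G. \<Sum>p<n. Suc p * nat (x (x_var (i - 1) p)))"

definition decode_plan :: "(var \<Rightarrow> int) \<Rightarrow> nat \<Rightarrow> nat set" where
  "decode_plan y = (\<lambda>j\<in>sensors G. {i \<in> targets G. y (y_var (i - 1) (j - 1)) = 1})"

lemma outer_vars_formulation: "outer_vars formulation = OuterBin ` {..<n * n}"
  by (auto simp: outer_var_list_def formulation_def)

lemma inner_vars_formulation: "inner_vars formulation = InnerBin ` {..<2 * (n * k) + n}"
  by (auto simp: inner_var_list_def formulation_def)

lemma x_var_outer: "i < n \<Longrightarrow> p < n \<Longrightarrow> x_var i p \<in> outer_vars formulation"
  by (simp add: outer_vars_formulation x_var_def flat_index_less)

lemma y_var_inner: "i < n \<Longrightarrow> j < k \<Longrightarrow> y_var i j \<in> inner_vars formulation"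
  using flat_index_less[of i n j k] by (simp add: inner_vars_formulation y_var_def)

lemma z_var_inner: "p < n \<Longrightarrow> j < k \<Longrightarrow> z_var p j \<in> inner_vars formulation"
  using flat_index_less[of p n j k] by (simp add: inner_vars_formulation z_var_def algebra_simps)

lemma u_var_inner: "i < n \<Longrightarrow> u_var i \<in> inner_vars formulation"
  by (simp add: inner_vars_formulation u_var_def)

lemma not_outer:
  "y_var i j \<notin> outer_vars formulation" "z_var p j \<notin> outer_vars formulation"
  "u_var i \<notin> outer_vars formulation"
  by (auto simp: outer_vars_formulation y_var_def z_var_def u_var_def)

lemma var_range_simps:
  "var_range (x_var i p) = {0, 1}" "var_range (y_var i j) = {0, 1}"
  "var_range (z_var p j) = {0, 1}" "var_range (u_var i) = {0, 1}"
  by (simp_all add: x_var_def y_var_def z_var_def u_var_def)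

lemma outer_constraints_formulation:
  "set (outer_constraints formulation) = (\<Union>i<n. set (order_constraints i))"
  by (auto simp: formulation_def)

lemma inner_constraints_formulation:
  "set (inner_constraints formulation) = (\<Union>i<n. set (cover_constraints i) \<union>
     (\<Union>j<k. {sense_constraint i j, window_constraint i j} \<union> link_constraint i j ` {..<n}))"
  by (fastforce simp: formulation_def)

lemma is_bilevel_formulation: "is_bilevel formulation"
proof -
  have "lin_vars l \<subseteq> outer_vars formulation" if "(l, b) \<in> set (outer_constraints formulation)" for l b
    using that x_var_outer
    by (fastforce simp: outer_constraints_formulation order_constraints_def lin_vars_map)
  moreover have "lin_vars l \<subseteq> outer_vars formulation \<union> inner_vars formulation"
    if "(l, b) \<in> set (inner_constraints formulation)" for l b
    using that x_var_outer y_var_inner z_var_inner u_var_inner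
    by (fastforce simp: inner_constraints_formulation cover_constraints_def sense_constraint_def
        link_constraint_def window_constraint_def lin_vars_map)
  moreover have "lin_vars (objective formulation) \<subseteq> inner_vars formulation"
    using u_var_inner by (auto simp: formulation_def lin_vars_map)
  ultimately show ?thesis unfolding is_bilevel_def by blast
qed

lemma outer_feasible_iff:
  "x \<in> outer_feasible formulation \<longleftrightarrow> x \<in> Pi\<^sub>E (outer_vars formulation) var_range \<and>
     (\<forall>i<n. (\<Sum>p<n. x (x_var i p)) = 1 \<and> (\<Sum>p<n. x (x_var p i)) \<le> 1)"
proof -
  have *: "real_of_int a \<le> 1 \<longleftrightarrow> a \<le> 1" "- real_of_int a \<le> -1 \<longleftrightarrow> a \<ge> 1" for a by linarith+
  have "(\<forall>c\<in>set (order_constraints i). satisfies x c) \<longleftrightarrow>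
      (\<Sum>p<n. x (x_var i p)) = 1 \<and> (\<Sum>p<n. x (x_var p i)) \<le> 1" for i
    by (auto simp: order_constraints_def satisfies_def lin_val_map sum_negf * simp flip: of_int_sum)
  moreover have "(\<forall>c\<in>set (outer_constraints formulation). satisfies x c) \<longleftrightarrow>
      (\<forall>i<n. \<forall>c\<in>set (order_constraints i). satisfies x c)"
    by (auto simp: outer_constraints_formulation)
  ultimately show ?thesis by (simp add: outer_feasible_def)
qed

lemma inner_feasible_iff:
  "y \<in> inner_feasible formulation x \<longleftrightarrow> y \<in> Pi\<^sub>E (inner_vars formulation) var_range \<and>
     (\<forall>i<n. y (u_var i) + (\<Sum>j<k. y (y_var i j)) = 1 \<and>
       (\<forall>j<k. y (y_var i j) \<le> of_bool (senses G (Suc i) (Suc j)) \<and>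
         (\<forall>p<n. y (y_var i j) + x (x_var i p) \<le> 1 + y (z_var p j)) \<and>
         (\<Sum>q<n. if i \<le> q \<and> q \<le> i + window then y (z_var q j) else 0) \<le> 1))"
proof -
  let ?a = "joint formulation x y"
  have *: "real_of_int a \<le> 1 \<longleftrightarrow> a \<le> 1" "- real_of_int a \<le> -1 \<longleftrightarrow> a \<ge> 1" for a by linarith+
  note a = joint_inner[OF not_outer(1)] joint_inner[OF not_outer(2)] joint_inner[OF not_outer(3)]
  have c: "(\<forall>c\<in>set (cover_constraints i). satisfies ?a c) \<longleftrightarrow>
      y (u_var i) + (\<Sum>j<k. y (y_var i j)) = 1" for i
  proof -
    have "(\<forall>c\<in>set (cover_constraints i). satisfies ?a c) \<longleftrightarrow>
      real_of_int (y (u_var i) + (\<Sum>j<k. y (y_var i j))) \<le> 1 \<and>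
      - real_of_int (y (u_var i) + (\<Sum>j<k. y (y_var i j))) \<le> -1"
      by (simp add: cover_constraints_def satisfies_def lin_val_map sum_negf a algebra_simps)
    then show ?thesis unfolding * by auto
  qed
  have s: "satisfies ?a (sense_constraint i j) \<longleftrightarrow>
      y (y_var i j) \<le> of_bool (senses G (Suc i) (Suc j))" for i j
    by (simp add: sense_constraint_def satisfies_def a)
  have l: "satisfies ?a (link_constraint i j p) \<longleftrightarrow> y (y_var i j) + x (x_var i p) \<le> 1 + y (z_var p j)"
    if "i < n" "p < n" for i j p
    using joint_outer[OF x_var_outer[OF that]]
    by (simp add: link_constraint_def satisfies_def a) linarith
  have w: "satisfies ?a (window_constraint i j) \<longleftrightarrow>
      (\<Sum>q<n. if i \<le> q \<and> q \<le> i + window then y (z_var q j) else 0) \<le> 1" for i j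
  proof -
    have "lin_val ?a (fst (window_constraint i j)) =
        real_of_int (\<Sum>q<n. if i \<le> q \<and> q \<le> i + window then y (z_var q j) else 0)"
      unfolding window_constraint_def fst_conv lin_val_map of_int_sum a
      by (intro sum.cong) auto
    then show ?thesis by (simp add: satisfies_def * window_constraint_def del: of_int_sum)
  qed
  have "(\<forall>c\<in>set (inner_constraints formulation). satisfies ?a c) \<longleftrightarrow>
    (\<forall>i<n. (\<forall>c\<in>set (cover_constraints i). satisfies ?a c) \<and>
       (\<forall>j<k. satisfies ?a (sense_constraint i j) \<and>
         (\<forall>p<n. satisfies ?a (link_constraint i j p)) \<and> satisfies ?a (window_constraint i j)))"
    unfolding inner_constraints_formulation by blast
  then show ?thesis by (simp add: inner_feasible_def c s l w)
qed

section \<open>Outer assignments and target orderings\<close>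

lemma outer_feasibleE:
  assumes "x \<in> outer_feasible formulation"
  obtains s where "bij_betw s {..<n} {..<n}"
    "\<And>i p. i < n \<Longrightarrow> p < n \<Longrightarrow> x (x_var i p) = of_bool (p = s i)"
    "\<And>i. i < n \<Longrightarrow> decode_ordering x (Suc i) = Suc (s i)"
proof -
  have x: "x (x_var i p) \<in> {0, 1}" if "i < n" "p < n" for i p
    using assms x_var_outer[OF that] var_range_simps(1)[of i p]
    unfolding outer_feasible_iff by (metis PiE_mem)
  have "\<exists>s<n. \<forall>p<n. x (x_var i p) = of_bool (p = s)" if "i < n" for i
    using binary_sum_eq_one[of n "\<lambda>p. x (x_var i p)"] assms that x
    unfolding outer_feasible_iff by metis
  then obtain s where s: "\<And>i. i < n \<Longrightarrow> s i < n"
    "\<And>i p. i < n \<Longrightarrow> p < n \<Longrightarrow> x (x_var i p) = of_bool (p = s i)" by metis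
  \<comment> \<open>Two rows with their 1 in the same column would push the sum of that column to
    2.\<close>
  have "inj_on s {..<n}"
  proof (rule inj_onI)
    fix a b assume ab: "a \<in> {..<n}" "b \<in> {..<n}" "s a = s b"
    then show "a = b"
      using binary_sum_le_oneD[of n "\<lambda>i. x (x_var i (s a))" a b] assms s x
      unfolding outer_feasible_iff by auto
  qed
  moreover have "s ` {..<n} \<subseteq> {..<n}" using s by auto
  ultimately have "bij_betw s {..<n} {..<n}"
    by (metis bij_betw_def endo_inj_surj finite_lessThan)
  moreover have "decode_ordering x (Suc i) = Suc (s i)" if "i < n" for i
  proof -
    have "decode_ordering x (Suc i) = (\<Sum>p<n. if p = s i then Suc p else 0)"
      using that s(2) unfolding decode_ordering_def targets_def
      by (auto intro!: sum.cong simp del: mult_Suc)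
    then show ?thesis using s(1)[OF that] by simp
  qed
  ultimately show thesis using s that by blast
qed

lemma targets_image: "targets G = Suc ` {..<n}"
  and sensors_image: "sensors G = Suc ` {..<k}"
  by (simp_all add: targets_def sensors_def lessThan_atLeast0 image_Suc_atLeastLessThan
      atLeastLessThanSuc_atLeastAtMost)

lemma decode_ordering_feasible:
  assumes "x \<in> outer_feasible formulation"
  shows "decode_ordering x \<in> orderings G"
proof -
  obtain s where s: "bij_betw s {..<n} {..<n}"
    "\<And>i. i < n \<Longrightarrow> decode_ordering x (Suc i) = Suc (s i)"
    using outer_feasibleE[OF assms] by metis
  have "bij_betw (decode_ordering x) (Suc ` {..<n}) (Suc ` {..<n})"
    using s by (auto simp: bij_betw_def inj_on_def image_image cong: image_cong_simp)
  then have "bij_betw (decode_ordering x) (targets G) {1..n}"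
    by (metis targets_def targets_image)
  then show ?thesis by (simp add: orderings_def decode_ordering_def)
qed

lemma decode_ordering_surj:
  assumes "\<sigma> \<in> orderings G"
  shows "\<sigma> \<in> decode_ordering ` outer_feasible formulation"
proof
  define X :: "nat \<Rightarrow> nat \<Rightarrow> int" where "X = (\<lambda>i p. of_bool (\<sigma> (Suc i) = Suc p))"
  \<comment> \<open>\<open>div\<close> and \<open>mod\<close> undo the row-major index. The default
    0 is never read, as all outer variables are of the form \<open>OuterBin\<close>.\<close>
  define x where "x = (\<lambda>v\<in>outer_vars formulation.
    case v of OuterBin q \<Rightarrow> X (q div n) (q mod n) | _ \<Rightarrow> 0)"
  have x: "x (x_var i p) = X i p" if "i < n" "p < n" for i p
    using x_var_outer[OF that] that by (simp add: x_def x_var_def)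
  have ext: "\<sigma> \<in> extensional (targets G)" and bij: "bij_betw \<sigma> (Suc ` {..<n}) (Suc ` {..<n})"
    using assms targets_image unfolding orderings_def targets_def by auto
  show f: "x \<in> outer_feasible formulation"
    unfolding outer_feasible_iff
  proof (intro conjI allI impI)
    show "x \<in> Pi\<^sub>E (outer_vars formulation) var_range"
      by (auto simp: x_def outer_vars_formulation X_def)
    fix i assume i: "i < n"
    have "\<exists>p<n. \<sigma> (Suc i) = Suc p" using bij i by (auto simp: bij_betw_def)
    then obtain p where "p < n" "\<sigma> (Suc i) = Suc p" by blast
    then have "(\<Sum>q<n. x (x_var i q)) = (\<Sum>q<n. if q = p then 1 else 0)"
      using i x by (intro sum.cong) (auto simp: X_def)
    then show "(\<Sum>q<n. x (x_var i q)) = 1" using \<open>p < n\<close> by simp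
    show "(\<Sum>p<n. x (x_var p i)) \<le> 1"
      using bij i x by (intro binary_sum_le_oneI) (auto simp: X_def bij_betw_def inj_on_def)
  qed
  \<comment> \<open>Feasibility of the constructed \<open>x\<close> yields its decoded values, so
    that the weighted sum is evaluated in one place only.\<close>
  obtain s where s: "bij_betw s {..<n} {..<n}"
    "\<And>i p. i < n \<Longrightarrow> p < n \<Longrightarrow> x (x_var i p) = of_bool (p = s i)"
    "\<And>i. i < n \<Longrightarrow> decode_ordering x (Suc i) = Suc (s i)"
    using outer_feasibleE[OF f] by metis
  show "\<sigma> = decode_ordering x"
  proof (rule extensionalityI[OF ext])
    show "decode_ordering x \<in> extensional (targets G)" by (simp add: decode_ordering_def)
    fix t assume "t \<in> targets G"
    then obtain i where i: "i < n" "t = Suc i" unfolding targets_image by auto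
    have "s i < n" using s(1) i by (auto simp: bij_betw_def)
    with i have "\<sigma> (Suc i) = Suc (s i)" using s(2)[of i "s i"] x[of i "s i"] by (simp add: X_def)
    then show "\<sigma> t = decode_ordering x t" using s(3) i by simp
  qed
qed

section \<open>Inner assignments and valid plans\<close>

lemma decode_plan_iff:
  "j < k \<Longrightarrow> t \<in> decode_plan y (Suc j) \<longleftrightarrow> (\<exists>i<n. t = Suc i \<and> y (y_var i j) = 1)"
  by (auto simp: decode_plan_def targets_image sensors_image)

lemma recharge_less_iff:
  assumes "a < n" "b < n"
  shows "enat (nat \<bar>int (Suc a) - int (Suc b)\<bar>) > recharge G \<longleftrightarrow> a > b + window \<or> b > a + window"
  using assms by (cases "recharge G") (auto simp: window_def)

lemma inner_feasible_range:
  assumes "y \<in> inner_feasible formulation x"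
  shows "i < n \<Longrightarrow> j < k \<Longrightarrow> y (y_var i j) \<in> {0, 1}"
    "i < n \<Longrightarrow> j < k \<Longrightarrow> y (z_var i j) \<in> {0, 1}" "i < n \<Longrightarrow> y (u_var i) \<in> {0, 1}"
  using assms PiE_mem[of y "inner_vars formulation" var_range] var_range_simps
    y_var_inner z_var_inner u_var_inner
  unfolding inner_feasible_iff by metis+

lemma decode_plan_feasible:
  assumes x: "x \<in> outer_feasible formulation" and y: "y \<in> inner_feasible formulation x"
  shows "decode_plan y \<in> valid_plans G (decode_ordering x)"
proof -
  obtain s where s: "bij_betw s {..<n} {..<n}"
    "\<And>i p. i < n \<Longrightarrow> p < n \<Longrightarrow> x (x_var i p) = of_bool (p = s i)"
    "\<And>i. i < n \<Longrightarrow> decode_ordering x (Suc i) = Suc (s i)"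
    using outer_feasibleE[OF x] by metis
  have sn: "s i < n" if "i < n" for i using s(1) that by (auto simp: bij_betw_def)
  note c = y[unfolded inner_feasible_iff, THEN conjunct2, rule_format]
  \<comment> \<open>Disjointness: the cover equation and \<open>u \<ge> 0\<close> bound each row sum
    of \<open>y\<close> by 1.\<close>
  have eq: "j = j'" if "i < n" "j < k" "j' < k" "y (y_var i j) = 1" "y (y_var i j') = 1" for i j j'
  proof (rule binary_sum_le_oneD[of k "\<lambda>j. y (y_var i j)"])
    show "(\<Sum>j<k. y (y_var i j)) \<le> 1"
      using c[OF that(1)] inner_feasible_range(3)[OF y that(1)] by auto
  qed (use that inner_feasible_range[OF y] in auto)
  have "decode_plan y \<in> plans G"
    unfolding plans_def disjoint_family_on_def
  proof (intro CollectI conjI ballI impI)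
    show "decode_plan y \<in> sensors G \<rightarrow>\<^sub>E Pow (targets G)" by (auto simp: decode_plan_def)
    fix a b assume "a \<in> sensors G" "b \<in> sensors G" "a \<noteq> b"
    then show "decode_plan y a \<inter> decode_plan y b = {}"
      using eq unfolding sensors_image by (auto simp: decode_plan_iff)
  qed
  moreover have "senses G t a" if a: "a \<in> sensors G" and t: "t \<in> decode_plan y a" for a t
  proof -
    obtain j where "a = Suc j" "j < k" using a unfolding sensors_image by auto
    moreover from this obtain i where "i < n" "t = Suc i" "y (y_var i j) = 1"
      using t by (auto simp: decode_plan_iff)
    ultimately show ?thesis using c[of i] by (cases "senses G t a") auto
  qed
  moreover have "enat (nat \<bar>int (decode_ordering x t) - int (decode_ordering x t')\<bar>) > recharge G"
    if a: "a \<in> sensors G" and t: "t \<in> decode_plan y a" "t' \<in> decode_plan y a" "t \<noteq> t'" for a t t'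
  proof -
    obtain i i' j where *: "a = Suc j" "j < k" "i < n" "t = Suc i" "y (y_var i j) = 1"
      "i' < n" "t' = Suc i'" "y (y_var i' j) = 1"
    proof -
      obtain j where "a = Suc j" "j < k" using a unfolding sensors_image by auto
      then show thesis using t that by (auto simp: decode_plan_iff)
    qed
    \<comment> \<open>The decisive window starts at the earlier position \<open>s a\<close>: if it
      reached \<open>s b\<close>, it would contain two reservations of the same sensor.\<close>
    have far: "s b > s a + window"
      if "a < n" "b < n" "y (y_var a j) = 1" "y (y_var b j) = 1" "s a < s b" for a b
    proof (rule ccontr)
      assume "\<not> s b > s a + window"
      \<comment> \<open>The link constraint at position \<open>s b\<close>, where \<open>x\<close>
        is 1, forces this reservation.\<close>
      moreover have z: "y (z_var (s b) j) = 1" if "b < n" "y (y_var b j) = 1" for b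
        using c[OF \<open>b < n\<close>] s(2)[OF that(1) sn[OF that(1)]] sn that \<open>j < k\<close>
          inner_feasible_range(2)[OF y sn[OF \<open>b < n\<close>] \<open>j < k\<close>] by fastforce
      let ?f = "\<lambda>q. if s a \<le> q \<and> q \<le> s a + window then y (z_var q j) else 0"
      have "(\<Sum>q<n. ?f q) \<le> 1" using c[OF sn[OF \<open>a < n\<close>]] \<open>j < k\<close> by blast
      moreover have "?f q \<in> {0, 1}" if "q < n" for q
        using inner_feasible_range(2)[OF y that \<open>j < k\<close>] by simp
      ultimately have "s a = s b"
        using binary_sum_le_oneD[of n ?f "s a" "s b"] that z[of a] z[of b] sn by simp
      then show False using \<open>s a < s b\<close> by simp
    qed
    have "s i \<noteq> s i'" using s(1) * t(3) by (auto simp: bij_betw_def inj_on_def)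
    then have "s i > s i' + window \<or> s i' > s i + window"
      using far[of i i'] far[of i' i] * by linarith
    then show ?thesis
      unfolding * s(3)[OF \<open>i < n\<close>] s(3)[OF \<open>i' < n\<close>] using recharge_less_iff sn * by blast
  qed
  ultimately show ?thesis by (simp add: valid_plans_def)
qed

lemma decode_plan_surj:
  assumes x: "x \<in> outer_feasible formulation" and \<psi>: "\<psi> \<in> valid_plans G (decode_ordering x)"
  shows "\<psi> \<in> decode_plan ` inner_feasible formulation x"
proof -
  obtain s where s: "bij_betw s {..<n} {..<n}"
    "\<And>i p. i < n \<Longrightarrow> p < n \<Longrightarrow> x (x_var i p) = of_bool (p = s i)"
    "\<And>i. i < n \<Longrightarrow> decode_ordering x (Suc i) = Suc (s i)"
    using outer_feasibleE[OF x] by metis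
  have sn: "s i < n" if "i < n" for i using s(1) that by (auto simp: bij_betw_def)
  have ext: "\<psi> \<in> extensional (sensors G)" and sub: "\<And>j. j < k \<Longrightarrow> \<psi> (Suc j) \<subseteq> targets G"
    and disj: "\<And>a b t. a < k \<Longrightarrow> b < k \<Longrightarrow> t \<in> \<psi> (Suc a) \<Longrightarrow> t \<in> \<psi> (Suc b) \<Longrightarrow> a = b"
    and sens: "\<And>j t. j < k \<Longrightarrow> t \<in> \<psi> (Suc j) \<Longrightarrow> senses G t (Suc j)"
    and rech: "\<And>i i' j. j < k \<Longrightarrow> i < n \<Longrightarrow> i' < n \<Longrightarrow> Suc i \<in> \<psi> (Suc j) \<Longrightarrow> Suc i' \<in> \<psi> (Suc j) \<Longrightarrow>
      i \<noteq> i' \<Longrightarrow> s i > s i' + window \<or> s i' > s i + window"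
  proof -
    show "\<psi> \<in> extensional (sensors G)" "\<And>j. j < k \<Longrightarrow> \<psi> (Suc j) \<subseteq> targets G"
      "\<And>j t. j < k \<Longrightarrow> t \<in> \<psi> (Suc j) \<Longrightarrow> senses G t (Suc j)"
      "\<And>a b t. a < k \<Longrightarrow> b < k \<Longrightarrow> t \<in> \<psi> (Suc a) \<Longrightarrow> t \<in> \<psi> (Suc b) \<Longrightarrow> a = b"
      using \<psi> unfolding valid_plans_def plans_def disjoint_family_on_def PiE_def sensors_image
      by blast+
    fix i i' j assume *: "j < k" "i < n" "i' < n" "Suc i \<in> \<psi> (Suc j)" "Suc i' \<in> \<psi> (Suc j)" "i \<noteq> i'"
    then have "enat (nat \<bar>int (decode_ordering x (Suc i)) - int (decode_ordering x (Suc i'))\<bar>) > recharge G"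
      using \<psi> unfolding valid_plans_def sensors_image by blast
    then show "s i > s i' + window \<or> s i' > s i + window"
      unfolding s(3)[OF *(2)] s(3)[OF *(3)] using recharge_less_iff sn * by blast
  qed
  define Y :: "nat \<Rightarrow> nat \<Rightarrow> int" where "Y = (\<lambda>i j. of_bool (Suc i \<in> \<psi> (Suc j)))"
  \<comment> \<open>The least possible reservations: only the positions of targets that the sensor
    senses.\<close>
  define Z :: "nat \<Rightarrow> nat \<Rightarrow> int" where "Z = (\<lambda>p j. of_bool (\<exists>i<n. s i = p \<and> Suc i \<in> \<psi> (Suc j)))"
  define U :: "nat \<Rightarrow> int" where "U = (\<lambda>i. of_bool (\<forall>j<k. Suc i \<notin> \<psi> (Suc j)))"
  \<comment> \<open>The inner binary variables form three consecutive blocks of sizes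
    \<open>n * k\<close>, \<open>n * k\<close> and \<open>n\<close>: incidences, reservations and
    indicators.\<close>
  define y where "y = (\<lambda>v\<in>inner_vars formulation. case v of InnerBin q \<Rightarrow>
    if q < n * k then Y (q div k) (q mod k)
    else if q < 2 * (n * k) then Z (q div k - n) (q mod k) else U (q - 2 * (n * k)) | _ \<Rightarrow> 0)"
  have Y: "y (y_var i j) = Y i j" if "i < n" "j < k" for i j
    using y_var_inner[OF that] flat_index_less[OF that] that by (simp add: y_def y_var_def)
  have Z: "y (z_var p j) = Z p j" if "p < n" "j < k" for p j
  proof -
    have "(n + p) * k + j < 2 * (n * k)"
      using flat_index_less[OF that] by (simp add: algebra_simps)
    moreover have "\<not> (n + p) * k + j < n * k" by (simp add: algebra_simps)
    moreover have "((n + p) * k + j) div k = n + p" "((n + p) * k + j) mod k = j" using that by simp_all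
    ultimately show ?thesis using z_var_inner[OF that] that by (simp add: y_def z_var_def)
  qed
  have U: "y (u_var i) = U i" if "i < n" for i
    using u_var_inner[OF that] that by (simp add: y_def u_var_def)
  have "y \<in> inner_feasible formulation x"
    unfolding inner_feasible_iff
  proof (intro conjI allI impI)
    show "y \<in> Pi\<^sub>E (inner_vars formulation) var_range"
      by (auto simp: y_def inner_vars_formulation Y_def Z_def U_def)
    fix i assume i: "i < n"
    show "y (u_var i) + (\<Sum>j<k. y (y_var i j)) = 1"
    proof (cases "\<exists>j<k. Suc i \<in> \<psi> (Suc j)")
      case True
      then obtain j where j: "j < k" "Suc i \<in> \<psi> (Suc j)" by blast
      then have "(\<Sum>j<k. y (y_var i j)) = (\<Sum>j'<k. if j' = j then 1 else 0)"
        using Y i disj by (intro sum.cong) (auto simp: Y_def)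
      then show ?thesis using j i U by (auto simp: U_def)
    next
      case False
      then have "(\<Sum>j<k. y (y_var i j)) = 0"
        using Y i by (intro sum.neutral) (auto simp: Y_def)
      then show ?thesis using False i U by (auto simp: U_def)
    qed
    fix j assume j: "j < k"
    show "y (y_var i j) \<le> of_bool (senses G (Suc i) (Suc j))"
      using sens[OF j, of "Suc i"] by (simp add: Y i j Y_def)
    show "y (y_var i j) + x (x_var i p) \<le> 1 + y (z_var p j)" if "p < n" for p
      using that i j s(2) by (auto simp: Y Z Y_def Z_def)
    show "(\<Sum>q<n. if i \<le> q \<and> q \<le> i + window then y (z_var q j) else 0) \<le> 1"
    proof (rule binary_sum_le_oneI)
      show "(if i \<le> q \<and> q \<le> i + window then y (z_var q j) else 0) \<in> {0, 1}" if "q < n" for q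
        using that j by (auto simp: Z Z_def)
      fix a b assume ab: "a < n" "b < n"
        "(if i \<le> a \<and> a \<le> i + window then y (z_var a j) else 0) = 1"
        "(if i \<le> b \<and> b \<le> i + window then y (z_var b j) else 0) = 1"
      then have *: "i \<le> a" "a \<le> i + window" "i \<le> b" "b \<le> i + window" "Z a j = 1" "Z b j = 1"
        using j by (auto simp: Z split: if_splits)
      then obtain a' b' where "a' < n" "b' < n" "s a' = a" "s b' = b"
        "Suc a' \<in> \<psi> (Suc j)" "Suc b' \<in> \<psi> (Suc j)" by (auto simp: Z_def)
      \<comment> \<open>Reservations in a common window stem from sensed targets \<open>a'\<close>
        and \<open>b'\<close>; distinct ones would be farther apart than the window is long.\<close>
      then show "a = b" using rech[OF j, of a' b'] * by (cases "a' = b'") auto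
    qed
  qed
  moreover have "\<psi> = decode_plan y"
  proof (rule extensionalityI[OF ext])
    show "decode_plan y \<in> extensional (sensors G)" by (simp add: decode_plan_def)
    fix a assume "a \<in> sensors G"
    then obtain j where j: "j < k" "a = Suc j" unfolding sensors_image by auto
    then show "\<psi> a = decode_plan y a"
      using sub[OF j(1)] by (auto simp: decode_plan_iff Y Y_def targets_image)
  qed
  ultimately show ?thesis by blast
qed

lemma objective_val_formulation:
  assumes y: "y \<in> inner_feasible formulation x"
  shows "objective_val formulation x y = unsensed_val G (decode_plan y)"
proof -
  let ?S = "\<Union>j\<in>sensors G. decode_plan y j"
  have u: "y (u_var i) = of_bool (Suc i \<notin> ?S)" if i: "i < n" for i
  proof -
    have c: "y (u_var i) + (\<Sum>j<k. y (y_var i j)) = 1" using y i unfolding inner_feasible_iff by blast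
    note r = inner_feasible_range[OF y]
    have S: "Suc i \<in> ?S \<longleftrightarrow> (\<exists>j<k. y (y_var i j) = 1)"
      using i by (auto simp: sensors_image decode_plan_iff)
    show ?thesis
    proof (cases "Suc i \<in> ?S")
      case True
      then obtain j where j: "j < k" "y (y_var i j) = 1" using S by blast
      have "y (y_var i j) \<le> (\<Sum>j<k. y (y_var i j))"
        using j r(1)[OF i] by (intro member_le_sum) fastforce+
      then show ?thesis using True c j r(3)[OF i] by auto
    next
      case False
      then have "(\<Sum>j<k. y (y_var i j)) = 0"
        using S r(1)[OF i] by (intro sum.neutral) fastforce
      then show ?thesis using False c by simp
    qed
  qed
  have "objective_val formulation x y = (\<Sum>i<n. target_val G (Suc i) * real_of_int (y (u_var i)))"
    by (simp add: objective_val_def formulation_def lin_val_map)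
      (simp add: joint_inner[OF not_outer(3), unfolded formulation_def])
  also have "\<dots> = (\<Sum>i<n. if Suc i \<notin> ?S then target_val G (Suc i) else 0)"
    using u by (intro sum.cong) auto
  also have "\<dots> = (\<Sum>i\<in>targets G. if i \<notin> ?S then target_val G i else 0)"
    unfolding targets_image by (simp add: sum.reindex)
  also have "\<dots> = (\<Sum>i\<in>targets G - ?S. target_val G i)"
    by (simp add: targets_def set_diff_eq flip: sum.inter_filter)
  finally show ?thesis by (simp add: unsensed_val_def)
qed

section \<open>From matching objectives to matching optima\<close>

lemma finite_plans: "finite (plans G)"
proof (rule finite_subset)
  show "plans G \<subseteq> sensors G \<rightarrow>\<^sub>E Pow (targets G)" unfolding plans_def by blast
  show "finite (sensors G \<rightarrow>\<^sub>E Pow (targets G))"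
    by (rule finite_PiE) (simp_all add: sensors_def targets_def)
qed

lemma finite_valid_plans: "finite (valid_plans G \<sigma>)"
  using finite_plans by (rule rev_finite_subset) (simp add: valid_plans_def)

text \<open>The plan in which no sensor senses anything is always valid. Together with finiteness
  this makes the minimum in \<open>ordering_val\<close> attained; \<open>Min\<close> has no useful
  value on empty or infinite sets.\<close>

lemma valid_plans_nonempty: "valid_plans G \<sigma> \<noteq> {}"
proof -
  have "(\<lambda>j\<in>sensors G. {}) \<in> valid_plans G \<sigma>"
    by (auto simp: valid_plans_def plans_def disjoint_family_on_def)
  then show ?thesis by blast
qed

lemma finite_orderings: "finite (orderings G)"
proof (rule finite_subset)
  show "orderings G \<subseteq> targets G \<rightarrow>\<^sub>E {1..n}"
    unfolding orderings_def PiE_def using bij_betwE by blast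
  show "finite (targets G \<rightarrow>\<^sub>E {1..n})"
    by (rule finite_PiE) (simp_all add: targets_def)
qed

text \<open>The objectives agree, so equilibria and bilevel optima correspond as soon as orderings and
  valid plans are encoded onto.\<close>

lemma bilevel_formulationI:
  assumes P: "is_bilevel P"
    and ord: "dec_ord ` outer_feasible P = orderings G"
    and plan: "\<And>x. x \<in> outer_feasible P \<Longrightarrow> dec_plan ` inner_feasible P x = valid_plans G (dec_ord x)"
    and obj: "\<And>x y. x \<in> outer_feasible P \<Longrightarrow> y \<in> inner_feasible P x \<Longrightarrow>
      objective_val P x y = unsensed_val G (dec_plan y)"
  shows "bilevel_formulation G P dec_ord dec_plan"
proof -
  have val: "ordering_val G \<sigma> \<le> unsensed_val G \<psi>" if "\<psi> \<in> valid_plans G \<sigma>" for \<sigma> \<psi>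
    unfolding ordering_val_def using finite_valid_plans that by (intro Min_le) auto
  have att: "\<exists>\<psi>\<in>valid_plans G \<sigma>. unsensed_val G \<psi> = ordering_val G \<sigma>" for \<sigma>
    using Min_in[of "unsensed_val G ` valid_plans G \<sigma>"] finite_valid_plans[of \<sigma>]
      valid_plans_nonempty[of \<sigma>] unfolding ordering_val_def by (fastforce simp del: Min_in)
  \<comment> \<open>Inner optimality becomes a condition on the value: some inner point decodes to a
    plan that attains the minimum over valid plans, so being minimal means having the value
    \<open>ordering_val\<close>.\<close>
  have feas: "bilevel_feasible P x y \<longleftrightarrow> x \<in> outer_feasible P \<and> y \<in> inner_feasible P x \<and>
      objective_val P x y = ordering_val G (dec_ord x)" for x y
  proof (cases "x \<in> outer_feasible P \<and> y \<in> inner_feasible P x")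
    case True
    then have x: "x \<in> outer_feasible P" and y: "y \<in> inner_feasible P x" by auto
    have ge: "ordering_val G (dec_ord x) \<le> objective_val P x y'" if "y' \<in> inner_feasible P x" for y'
      using val[of "dec_plan y'" "dec_ord x"] plan[OF x] obj[OF x that] that by auto
    obtain y0 where "y0 \<in> inner_feasible P x" "objective_val P x y0 = ordering_val G (dec_ord x)"
    proof -
      obtain \<psi> where "\<psi> \<in> valid_plans G (dec_ord x)" "unsensed_val G \<psi> = ordering_val G (dec_ord x)"
        using att by blast
      then obtain y0 where "y0 \<in> inner_feasible P x" "\<psi> = dec_plan y0" using plan[OF x] by force
      then show thesis using that obj[OF x] \<open>unsensed_val G \<psi> = _\<close> by metis
    qed
    then show ?thesis
      unfolding bilevel_feasible_def is_arg_min_def using x y ge by (metis not_less order_antisym_conv)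
  qed (auto simp: bilevel_feasible_def is_arg_min_def)
  have max: "ordering_val G \<sigma> \<le> blue_leader_val G" if "\<sigma> \<in> orderings G" for \<sigma>
    unfolding blue_leader_val_def using finite_orderings that by (intro Max_ge) auto
  \<comment> \<open>Every ordering with a best response has a feasible preimage; both directions of
    the correspondence of optima rely on such preimages.\<close>
  have lift: "\<exists>x y. bilevel_feasible P x y \<and> \<sigma> = dec_ord x \<and> \<psi> = dec_plan y"
    if \<sigma>: "\<sigma> \<in> orderings G" and \<psi>: "\<psi> \<in> valid_plans G \<sigma>" "unsensed_val G \<psi> = ordering_val G \<sigma>"
    for \<sigma> \<psi>
  proof -
    obtain x where x: "x \<in> outer_feasible P" "\<sigma> = dec_ord x" using \<sigma> ord by blast
    have "\<psi> \<in> dec_plan ` inner_feasible P x" using \<psi>(1) plan[OF x(1)] x(2) by simp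
    then obtain y where y: "y \<in> inner_feasible P x" "\<psi> = dec_plan y" by blast
    have "bilevel_feasible P x y" unfolding feas using x y obj[OF x(1) y(1)] \<psi>(2) by simp
    then show ?thesis using x(2) y(2) by blast
  qed
  have dec: "dec_ord x \<in> orderings G \<and> dec_plan y \<in> valid_plans G (dec_ord x) \<and>
      unsensed_val G (dec_plan y) = objective_val P x y \<and>
      objective_val P x y = ordering_val G (dec_ord x)"
    if "bilevel_feasible P x y" for x y
  proof -
    have x: "x \<in> outer_feasible P" and y: "y \<in> inner_feasible P x"
      and v: "objective_val P x y = ordering_val G (dec_ord x)" using that by (simp_all add: feas)
    show ?thesis using ord plan[OF x] obj[OF x y] x y v by (metis imageI)
  qed
  have "blue_leader_equilibrium G (dec_ord x) (dec_plan y)" if "bilevel_optimal P x y" for x y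
  proof -
    have f: "bilevel_feasible P x y" using that by (simp add: bilevel_optimal_def)
    \<comment> \<open>\<open>Max_in\<close> asks for a nonempty set; the given optimum supplies an
      ordering.\<close>
    have ne: "orderings G \<noteq> {}" using dec[OF f] by blast
    have "blue_leader_val G \<in> ordering_val G ` orderings G"
      unfolding blue_leader_val_def using finite_orderings ne by (intro Max_in) auto
    then obtain \<sigma> where \<sigma>: "\<sigma> \<in> orderings G" "ordering_val G \<sigma> = blue_leader_val G" by auto
    obtain \<psi> where "\<psi> \<in> valid_plans G \<sigma>" "unsensed_val G \<psi> = ordering_val G \<sigma>" using att by blast
    then obtain x' y' where "bilevel_feasible P x' y'" "\<sigma> = dec_ord x'" using lift \<sigma>(1) by blast
    then have "blue_leader_val G \<le> objective_val P x y"
      using that dec \<sigma> unfolding bilevel_optimal_def by metis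
    then show ?thesis
      using dec[OF f] max[of "dec_ord x"] unfolding blue_leader_equilibrium_def by linarith
  qed
  moreover have "\<exists>x y. (\<sigma>, \<psi>) = (dec_ord x, dec_plan y) \<and> bilevel_optimal P x y"
    if eq: "blue_leader_equilibrium G \<sigma> \<psi>" for \<sigma> \<psi>
  proof -
    obtain x y where *: "bilevel_feasible P x y" "\<sigma> = dec_ord x" "\<psi> = dec_plan y"
      using eq lift[of \<sigma> \<psi>] unfolding blue_leader_equilibrium_def by blast
    then have "bilevel_optimal P x y"
      using eq dec max unfolding bilevel_optimal_def blue_leader_equilibrium_def by metis
    then show ?thesis using * by blast
  qed
  ultimately have "{(dec_ord x, dec_plan y) | x y. bilevel_optimal P x y} =
      {(\<sigma>, \<psi>). blue_leader_equilibrium G \<sigma> \<psi>}" by blast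
  then show ?thesis using P ord plan obj by (simp add: bilevel_formulation_def)
qed

lemma bilevel_formulation_formulation:
  "bilevel_formulation G formulation decode_ordering decode_plan"
proof (rule bilevel_formulationI)
  show "decode_ordering ` outer_feasible formulation = orderings G"
    using decode_ordering_feasible decode_ordering_surj by blast
  show "decode_plan ` inner_feasible formulation x = valid_plans G (decode_ordering x)"
    if "x \<in> outer_feasible formulation" for x
    using decode_plan_feasible[OF that] decode_plan_surj[OF that] by blast
qed (simp_all add: is_bilevel_formulation objective_val_formulation)

section \<open>Size of the program\<close>

lemma formulation_size:
  assumes "1 \<le> n" "1 \<le> k"
  shows "num_binary_vars formulation \<le> 8 * (n\<^sup>2 + n * k)"
    "num_integer_vars formulation \<le> 8 * n"
    "num_constraints formulation \<le> 8 * (n\<^sup>2 * k)"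
proof -
  have n: "n \<le> n * n" using assms by simp
  have "num_binary_vars formulation = n * n + 2 * (n * k) + n"
    by (simp add: num_binary_vars_def formulation_def)
  also have "\<dots> \<le> 8 * (n\<^sup>2 + n * k)" unfolding power2_eq_square distrib_left using n by linarith
  finally show "num_binary_vars formulation \<le> 8 * (n\<^sup>2 + n * k)" .
  show "num_integer_vars formulation \<le> 8 * n"
    by (simp add: num_integer_vars_def formulation_def)
  \<comment> \<open>The constant 8 is 3 + 2 + 1 + 2: order constraints \<open>3 * n\<close>, cover
    constraints \<open>2 * n\<close>, links \<open>n * n * k\<close>, and sensing with windows
    \<open>2 * (n * k)\<close>. Positive \<open>n\<close> and \<open>k\<close> lift each monomial to
    \<open>n * n * k\<close>.\<close>
  have "n * 1 * 1 \<le> n * n * k" "n * 1 * k \<le> n * n * k"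
    using assms by (intro mult_le_mono; simp)+
  moreover have "num_constraints formulation = n * 3 + n * (2 + k * (n + 2))"
    by (simp add: num_constraints_def formulation_def length_concat o_def order_constraints_def
        cover_constraints_def sum_list_triv)
  moreover have "n * (2 + k * (n + 2)) = 2 * n + n * n * k + 2 * (n * k)"
    by (simp add: algebra_simps)
  ultimately show "num_constraints formulation \<le> 8 * (n\<^sup>2 * k)"
    unfolding power2_eq_square by linarith
qed

section \<open>Layout of the input, counted from 0\<close>

lemma encode_esg_eq:
  "encode_esg G = [real n, real k] @ (case recharge G of enat d \<Rightarrow> [1, real d] | \<infinity> \<Rightarrow> [0, 0]) @
     map (\<lambda>i. target_val G (Suc i)) [0..<n] @
     concat (map (\<lambda>i. map (\<lambda>j. of_bool (senses G (Suc i) (Suc j))) [0..<k]) [0..<n])"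
  unfolding encode_esg_def One_nat_def map_Suc_upt[symmetric] map_map o_def by simp

lemma encode_ordering_eq: "encode_ordering G \<sigma> = map (\<lambda>i. real (\<sigma> (Suc i))) [0..<n]"
  unfolding encode_ordering_def One_nat_def map_Suc_upt[symmetric] map_map o_def by simp

lemma encode_plan_eq: "encode_plan G \<psi> =
    concat (map (\<lambda>i. map (\<lambda>j. of_bool (Suc i \<in> \<psi> (Suc j))) [0..<k]) [0..<n])"
  unfolding encode_plan_def One_nat_def map_Suc_upt[symmetric] map_map o_def by simp

lemma length_encode_esg: "length (encode_esg G) = 4 + n + n * k"
  by (simp add: encode_esg_eq length_concat o_def sum_list_triv split: enat.split)

text \<open>The four leading entries are the two sizes and the code of the recharging time. This
  code has two entries in the finite and in the infinite case, which keeps all later offsets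
  fixed.\<close>

lemma nth_encode_esg:
  "i < n \<Longrightarrow> encode_esg G ! (4 + i) = target_val G (Suc i)"
  "i < n \<Longrightarrow> j < k \<Longrightarrow> encode_esg G ! (4 + n + (i * k + j)) = of_bool (senses G (Suc i) (Suc j))"
proof -
  have *: "encode_esg G = (case recharge G of enat d \<Rightarrow> [real n, real k, 1, real d] |
      \<infinity> \<Rightarrow> [real n, real k, 0, 0]) @ map (\<lambda>i. target_val G (Suc i)) [0..<n] @
     concat (map (\<lambda>i. map (\<lambda>j. of_bool (senses G (Suc i) (Suc j))) [0..<k]) [0..<n])"
    by (simp add: encode_esg_eq split: enat.split)
  have l: "length (case recharge G of enat d \<Rightarrow> [real n, real k, 1, real d] |
      \<infinity> \<Rightarrow> [real n, real k, 0, 0]) = 4" by (simp split: enat.split)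
  show "i < n \<Longrightarrow> encode_esg G ! (4 + i) = target_val G (Suc i)"
    unfolding * by (simp add: nth_append l)
  show "i < n \<Longrightarrow> j < k \<Longrightarrow> encode_esg G ! (4 + n + (i * k + j)) = of_bool (senses G (Suc i) (Suc j))"
    unfolding * by (simp add: nth_append l nth_concat_map_upt)
qed

text \<open>\<open>rest\<close> is what follows the game in the input: nothing when the bilevel
  program is constructed, an assignment when one is decoded.\<close>

context fixes rest inp :: "real list" defines "inp \<equiv> encode_esg G @ rest" begin

text \<open>Only the \<open>n * k\<close> entries of the sensing matrix bound \<open>k\<close> by
  the input length, so the bound fails without targets. For this reason every loop over sensors sits
  inside a loop over targets.\<close>

lemma n_le: "n \<le> length inp" and k_le: "0 < n \<Longrightarrow> k \<le> length inp"
proof -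
  show "n \<le> length inp" by (simp add: inp_def length_encode_esg)
  assume "0 < n"
  then have "k \<le> n * k" by simp
  then show "k \<le> length inp" unfolding inp_def length_append length_encode_esg by linarith
qed

lemma inp_esg: "q < 4 + n + n * k \<Longrightarrow> inp ! q = encode_esg G ! q"
  by (simp add: inp_def nth_append length_encode_esg)

lemma inp_rest: "inp ! (4 + n + n * k + q) = rest ! q"
  by (simp add: inp_def nth_append length_encode_esg)

end

end


section \<open>Programs that emit lists\<close>

text \<open>\<open>agrees m vs\<close> fixes the cells \<open>0, \<dots>, length vs - 1\<close>. A program fragment may use all further
  cells as scratch space, so nesting fragments never clobbers an outer loop variable.\<close>

definition agrees :: "(nat \<Rightarrow> real) \<Rightarrow> real list \<Rightarrow> bool" where
  "agrees m vs \<longleftrightarrow> (\<forall>c<length vs. m c = vs ! c)"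

definition evals :: "real list \<Rightarrow> real list \<Rightarrow> expr \<Rightarrow> real \<Rightarrow> bool" where
  "evals inp vs e r \<longleftrightarrow> (\<forall>m. agrees m vs \<longrightarrow> expr_val inp m e = r)"

text \<open>A Hoare triple with output and time. \<open>c\<close> and \<open>e\<close> must be the
  same for all instances if one polynomial is to bound them all; \<open>Suc\<close> keeps the base
  of the power at least 1, so that bounds grow with the exponent.\<close>

definition emits :: "real list \<Rightarrow> real list \<Rightarrow> program \<Rightarrow> real list \<Rightarrow> nat \<Rightarrow> nat \<Rightarrow> bool" where
  "emits inp vs p xs c e \<longleftrightarrow> (\<forall>m out. agrees m vs \<longrightarrow>
    (\<exists>m' t. agrees m' vs \<and> t \<le> c * Suc (length inp) ^ e \<and> run inp p (m, out) t (m', out @ xs)))"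

abbreviation cell :: "nat \<Rightarrow> expr" where "cell c \<equiv> Cell (Const (int c))"

definition let_in :: "nat \<Rightarrow> expr \<Rightarrow> program \<Rightarrow> program" where
  "let_in c e p = Seq (Store (Const (int c)) e) p"

text \<open>The machine only tests \<open><=\<close>; for natural values, \<open>c + 1 <= e\<close>
  expresses \<open>c < e\<close>.\<close>

definition for_loop :: "nat \<Rightarrow> expr \<Rightarrow> program \<Rightarrow> program" where
  "for_loop c e p = let_in c (Const 0) (WhileLe (Plus (cell c) (Const 1)) e
     (Seq p (Store (Const (int c)) (Plus (cell c) (Const 1)))))"

text \<open>The machine cannot multiply, so products of sizes and indices are formed by repeated addition.\<close>

definition let_mult :: "nat \<Rightarrow> expr \<Rightarrow> expr \<Rightarrow> program \<Rightarrow> program" where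
  "let_mult c e f p = let_in c (Const 0)
     (Seq (for_loop (Suc c) e (Store (Const (int c)) (Plus (cell c) f))) p)"

text \<open>A store to an address that is not a natural number has no effect.\<close>

fun emit_list :: "expr list \<Rightarrow> program" where
  "emit_list [] = Store (Const (-1)) (Const 0)"
| "emit_list (e # es) = Seq (Emit e) (emit_list es)"

section \<open>Compositional rules for output and running time\<close>

lemma agrees_snoc: "agrees m (vs @ [r]) \<longleftrightarrow> agrees m vs \<and> m (length vs) = r"
  by (auto simp: agrees_def nth_append less_Suc_eq)

lemma agrees_upd: "length vs \<le> c \<Longrightarrow> agrees (m(c := r)) vs \<longleftrightarrow> agrees m vs"
  by (auto simp: agrees_def)

lemma expr_val_cell [simp]: "expr_val inp m (cell c) = m c"
  by simp

lemma store_const [simp]: "store m (real c) r = m(c := r)" "store m (-1) r = m"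
proof -
  show "store m (real c) r = m(c := r)" by (simp add: store_def)
  have "(-1 :: real) \<notin> \<nat>" by (auto simp: Nats_def)
  then show "store m (-1) r = m" by (simp add: store_def)
qed

lemma evals_const: "evals inp vs (Const a) (of_int a)"
  and evals_cell: "c < length vs \<Longrightarrow> evals inp vs (cell c) (vs ! c)"
  and evals_plus: "evals inp vs e r \<Longrightarrow> evals inp vs f s \<Longrightarrow> evals inp vs (Plus e f) (r + s)"
  and evals_minus: "evals inp vs e r \<Longrightarrow> evals inp vs f s \<Longrightarrow> evals inp vs (Minus e f) (r - s)"
  by (simp_all add: evals_def agrees_def)

lemma evals_input:
  "evals inp vs e r \<Longrightarrow> r = real a \<Longrightarrow> a < length inp \<Longrightarrow> inp ! a = s \<Longrightarrow> evals inp vs (Input e) s"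
  by (auto simp: evals_def)

lemmas evals_intros = evals_const evals_cell evals_plus evals_minus

text \<open>Applied first in the proofs about programs, it leaves output and cost schematic: the
  structural rules compute both from the syntax, and only then are they compared with the intended
  encoding and with rounded constants.\<close>

lemma emits_weaken:
  assumes "emits inp vs p xs c e" "xs = ys" "c \<le> c'" "e \<le> e'"
  shows "emits inp vs p ys c' e'"
proof -
  have "c * Suc (length inp) ^ e \<le> c' * Suc (length inp) ^ e'"
    using assms by (intro mult_le_mono power_increasing) auto
  then show ?thesis using assms(1,2) unfolding emits_def by (meson le_trans)
qed

lemma emits_seq:
  assumes "emits inp vs p xs c e" "emits inp vs q ys d f"
  shows "emits inp vs (Seq p q) (xs @ ys) (c + d) (max e f)"
  unfolding emits_def
proof (intro allI impI)
  fix m out assume "agrees m vs"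
  then obtain m' t where 1: "agrees m' vs" "t \<le> c * Suc (length inp) ^ e"
      "run inp p (m, out) t (m', out @ xs)"
    using assms(1) unfolding emits_def by blast
  then obtain m'' u where 2: "agrees m'' vs" "u \<le> d * Suc (length inp) ^ f"
      "run inp q (m', out @ xs) u (m'', (out @ xs) @ ys)"
    using assms(2) unfolding emits_def by blast
  have "c * Suc (length inp) ^ e \<le> c * Suc (length inp) ^ max e f"
    "d * Suc (length inp) ^ f \<le> d * Suc (length inp) ^ max e f"
    by (intro mult_le_mono power_increasing; simp)+
  then have "t + u \<le> (c + d) * Suc (length inp) ^ max e f"
    using 1(2) 2(2) unfolding distrib_right by linarith
  then show "\<exists>m' t. agrees m' vs \<and> t \<le> (c + d) * Suc (length inp) ^ max e f \<and>
      run inp (Seq p q) (m, out) t (m', out @ xs @ ys)"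
    using 2(1) run.Seq[OF 1(3) 2(3)] by auto
qed

lemma emits_emit_list:
  assumes "list_all2 (evals inp vs) es rs"
  shows "emits inp vs (emit_list es) rs (Suc (length es)) 0"
  using assms
proof (induction es rs)
  case Nil
  have "run inp (emit_list []) (m, out) 1 (m, out @ [])" for m out
    using run.Store[of inp "Const (-1)" "Const 0" m out] by simp
  then show ?case unfolding emits_def by fastforce
next
  case (Cons e es r rs)
  have "emits inp vs (Emit e) [r] 1 0"
    using Cons(1) run.Emit[of inp e] unfolding emits_def evals_def by fastforce
  from emits_seq[OF this Cons(3)] show ?case by simp
qed

text \<open>The new cell is scoped: \<open>p\<close> may rely on it, but afterwards only
  \<open>vs\<close> is guaranteed, so later fragments can reuse it.\<close>

lemma emits_let_in:
  assumes c: "c = length vs" and e: "evals inp vs e r" and p: "emits inp (vs @ [r]) p xs d f"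
  shows "emits inp vs (let_in c e p) xs (Suc d) f"
  unfolding emits_def
proof (intro allI impI)
  fix m out assume m: "agrees m vs"
  have 1: "run inp (Store (Const (int c)) e) (m, out) 1 (m(c := r), out)"
    using run.Store[of inp "Const (int c)" e m out] e m by (simp add: evals_def)
  have "agrees (m(c := r)) (vs @ [r])" using m c by (simp add: agrees_snoc agrees_upd)
  then obtain m' t where 2: "agrees m' (vs @ [r])" "t \<le> d * Suc (length inp) ^ f"
      "run inp p (m(c := r), out) t (m', out @ xs)"
    using p unfolding emits_def by blast
  have "1 \<le> Suc (length inp) ^ f" by simp
  then have "1 + t \<le> Suc d * Suc (length inp) ^ f"
    using 2(2) unfolding mult_Suc by linarith
  then show "\<exists>m' t. agrees m' vs \<and> t \<le> Suc d * Suc (length inp) ^ f \<and>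
      run inp (let_in c e p) (m, out) t (m', out @ xs)"
    using run.Seq[OF 1 2(3)] 2(1) unfolding let_in_def agrees_snoc by blast
qed

text \<open>The invariant is left open because its two uses differ: a for loop preserves all cells
  below its counter, whereas multiplication changes an accumulator in every round.\<close>

lemma run_while:
  assumes bound: "\<And>m i. I i m \<Longrightarrow> i \<le> n \<Longrightarrow> m c = real i \<and> expr_val inp m e = real n"
    and body: "\<And>m i out. I i m \<Longrightarrow> i < n \<Longrightarrow> \<exists>m' t. t \<le> T \<and> run inp p (m, out) t (m', out @ xs i) \<and>
      m' c = real i \<and> I (Suc i) (m'(c := real (Suc i)))"
    and init: "I i m" "i \<le> n"
  shows "\<exists>m' t. t \<le> (n - i) * (T + 2) + 1 \<and> I n m' \<and>
    run inp (WhileLe (Plus (cell c) (Const 1)) e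
      (Seq p (Store (Const (int c)) (Plus (cell c) (Const 1))))) (m, out) t
      (m', out @ concat (map xs [i..<n]))"
  using init
proof (induction "n - i" arbitrary: i m out)
  case 0
  then show ?case
    using bound[of i m] run.WhileFalse[of inp m "Plus (cell c) (Const 1)" e _ out] by fastforce
next
  case (Suc d)
  then have i: "i < n" by simp
  obtain m1 t1 where 1: "t1 \<le> T" "run inp p (m, out) t1 (m1, out @ xs i)" "m1 c = real i"
      "I (Suc i) (m1(c := real (Suc i)))"
    using body[OF Suc(3) i] by blast
  have s: "run inp (Store (Const (int c)) (Plus (cell c) (Const 1))) (m1, out @ xs i) 1
      (m1(c := real (Suc i)), out @ xs i)"
    using run.Store[of inp "Const (int c)" "Plus (cell c) (Const 1)" m1 "out @ xs i"] 1(3)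
    by (simp add: add.commute)
  obtain m2 t2 where 2: "t2 \<le> (n - Suc i) * (T + 2) + 1" "I n m2"
    "run inp (WhileLe (Plus (cell c) (Const 1)) e
      (Seq p (Store (Const (int c)) (Plus (cell c) (Const 1))))) (m1(c := real (Suc i)), out @ xs i) t2
      (m2, (out @ xs i) @ concat (map xs [Suc i..<n]))"
    using Suc(1)[OF _ 1(4), of "out @ xs i"] Suc(2) i by (metis Suc_leI Suc_diff_Suc nat.inject)
  have le: "expr_val inp m (Plus (cell c) (Const 1)) \<le> expr_val inp m e"
    using bound[OF Suc(3)] i by simp
  have "Suc (t1 + 1 + t2) \<le> (n - i) * (T + 2) + 1"
    using 1(1) 2(1) Suc_diff_Suc[OF i] by (simp flip: Suc_diff_Suc[OF i])
  then show ?case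
    using run.WhileTrue[OF le run.Seq[OF 1(2) s] 2(3)] 2(2) i by (auto simp: upt_conv_Cons)
qed

text \<open>A loop raises the degree of the time bound by one. The additional 4 covers test and
  increment of each round, the initial store and the last, failing test.\<close>

lemma loop_time: "n < L \<Longrightarrow> n * (d * L ^ f + 2) + 2 \<le> (d + 4) * L ^ Suc f" for L :: nat
proof -
  assume n: "n < L"
  then have "n * (d * L ^ f) \<le> L * (d * L ^ f)" by (intro mult_le_mono) simp_all
  moreover have "L \<le> L * L ^ f" using n by simp
  moreover have "(d + 4) * L ^ Suc f = L * (d * L ^ f) + 4 * (L * L ^ f)"
    by (simp add: algebra_simps)
  ultimately show ?thesis using n unfolding distrib_left by linarith
qed

lemma emits_for_loop:
  assumes c: "c = length vs" and e: "evals inp vs e (real n)" and n: "n \<le> length inp"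
    and p: "\<And>i. i < n \<Longrightarrow> emits inp (vs @ [real i]) p (xs i) d f"
  shows "emits inp vs (for_loop c e p) (concat (map xs [0..<n])) (d + 4) (Suc f)"
  unfolding emits_def
proof (intro allI impI)
  fix m out assume m: "agrees m vs"
  let ?w = "WhileLe (Plus (cell c) (Const 1)) e
      (Seq p (Store (Const (int c)) (Plus (cell c) (Const 1))))"
  let ?L = "Suc (length inp)"
  have 1: "run inp (Store (Const (int c)) (Const 0)) (m, out) 1 (m(c := 0), out)"
    using run.Store[of inp "Const (int c)" "Const 0" m out] by simp
  have "\<exists>m' t. t \<le> (n - 0) * (d * ?L ^ f + 2) + 1 \<and> agrees m' (vs @ [real n]) \<and>
      run inp ?w (m(c := 0), out) t (m', out @ concat (map xs [0..<n]))"
  proof (rule run_while[where I = "\<lambda>i m. agrees m (vs @ [real i])"])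
    show "agrees (m(c := 0)) (vs @ [real 0])" using m c by (simp add: agrees_snoc agrees_upd)
    show "m c = real i \<and> expr_val inp m e = real n" if "agrees m (vs @ [real i])" for m i
      using that e c by (simp add: agrees_snoc evals_def)
    show "\<exists>m' t. t \<le> d * ?L ^ f \<and> run inp p (m, out) t (m', out @ xs i) \<and>
        m' c = real i \<and> agrees (m'(c := real (Suc i))) (vs @ [real (Suc i)])"
      if m: "agrees m (vs @ [real i])" and i: "i < n" for m i out
    proof -
      obtain m' t where "agrees m' (vs @ [real i])" "t \<le> d * ?L ^ f"
          "run inp p (m, out) t (m', out @ xs i)"
        using p[OF i] m unfolding emits_def by blast
      then show ?thesis using c by (intro exI[of _ m'] exI[of _ t]) (simp add: agrees_snoc agrees_upd)
    qed
  qed simp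
  then obtain m' t where 2: "t \<le> n * (d * ?L ^ f + 2) + 1" "agrees m' (vs @ [real n])"
    "run inp ?w (m(c := 0), out) t (m', out @ concat (map xs [0..<n]))" by auto
  have "1 + t \<le> (d + 4) * ?L ^ Suc f" using 2(1) loop_time[of n ?L d f] n by simp
  then show "\<exists>m' t. agrees m' vs \<and> t \<le> (d + 4) * ?L ^ Suc f \<and>
      run inp (for_loop c e p) (m, out) t (m', out @ concat (map xs [0..<n]))"
    using run.Seq[OF 1 2(3)] 2(2) unfolding for_loop_def let_in_def agrees_snoc by blast
qed

lemma concat_map_Nil: "concat (map (\<lambda>i. []) xs) = []"
  by simp

text \<open>The for-loop rule does not fit, since it makes the body preserve all cells below the
  counter, and here the cell just below is the accumulator. The number of rounds is natural, but the
  factor \<open>s\<close> may be any real.\<close>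

lemma emits_let_mult:
  assumes c: "c = length vs" and e: "evals inp vs e (real n)" and n: "n \<le> length inp"
    and g: "evals inp vs g s" and p: "emits inp (vs @ [real n * s]) p xs d f"
  shows "emits inp vs (let_mult c e g p) xs (d + 6) (Suc f)"
  unfolding emits_def
proof (intro allI impI)
  fix m out assume m: "agrees m vs"
  let ?b = "Store (Const (int c)) (Plus (cell c) g)"
  let ?w = "WhileLe (Plus (cell (Suc c)) (Const 1)) e
      (Seq ?b (Store (Const (int (Suc c))) (Plus (cell (Suc c)) (Const 1))))"
  let ?L = "Suc (length inp)"
  let ?I = "\<lambda>i m. agrees m (vs @ [real i * s, real i])"
  have agr: "agrees m (vs @ [a, b]) \<longleftrightarrow> agrees m vs \<and> m c = a \<and> m (Suc c) = b" for m a b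
    using agrees_snoc[of m "vs @ [a]" b] c by (simp add: agrees_snoc)
  have 1: "run inp (Store (Const (int c)) (Const 0)) (m, out) 1 (m(c := 0), out)"
    using run.Store[of inp "Const (int c)" "Const 0" m out] by simp
  have 2: "run inp (Store (Const (int (Suc c))) (Const 0)) (m(c := 0), out) 1 (m(c := 0, Suc c := 0), out)"
    using run.Store[of inp "Const (int (Suc c))" "Const 0" "m(c := 0)" out]
    by (simp del: of_nat_Suc)
  have "\<exists>m' t. t \<le> (n - 0) * (1 + 2) + 1 \<and> ?I n m' \<and>
      run inp ?w (m(c := 0, Suc c := 0), out) t (m', out @ concat (map (\<lambda>i. []) [0..<n]))"
  proof (rule run_while[where I = ?I])
    show "?I 0 (m(c := 0, Suc c := 0))" using m c by (simp add: agr agrees_upd)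
    show "m (Suc c) = real i \<and> expr_val inp m e = real n" if "?I i m" for m i
      using that e by (simp add: agr evals_def)
    show "\<exists>m' t. t \<le> 1 \<and> run inp ?b (m, out) t (m', out @ []) \<and>
        m' (Suc c) = real i \<and> ?I (Suc i) (m'(Suc c := real (Suc i)))"
      if m: "?I i m" for m i out
    proof -
      have "run inp ?b (m, out) 1 (m(c := m c + s), out)"
        using run.Store[of inp "Const (int c)" "Plus (cell c) g" m out] m g
        by (simp add: agr evals_def)
      then show ?thesis using m c
        by (intro exI[of _ "m(c := m c + s)"] exI[of _ 1]) (simp add: agr agrees_upd algebra_simps)
    qed
  qed simp
  then obtain m' t where 3: "t \<le> n * 3 + 1" "?I n m'"
    "run inp ?w (m(c := 0, Suc c := 0), out) t (m', out)"
    by (simp only: concat_map_Nil append_Nil2 diff_zero one_plus_numeral add_One) auto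
  then have "agrees m' (vs @ [real n * s])" using c by (simp add: agr agrees_snoc)
  then obtain m'' u where 4: "agrees m'' (vs @ [real n * s])" "u \<le> d * ?L ^ f"
      "run inp p (m', out) u (m'', out @ xs)"
    using p unfolding emits_def by blast
  have "d * ?L ^ f \<le> d * ?L ^ Suc f" by (intro mult_le_mono power_increasing) simp_all
  moreover have "?L \<le> ?L ^ Suc f" using power_increasing[of 1 "Suc f" ?L] by simp
  ultimately have "1 + (1 + t + u) \<le> (d + 6) * ?L ^ Suc f"
    using 3(1) 4(2) n unfolding distrib_right by linarith
  then show "\<exists>m' t. agrees m' vs \<and> t \<le> (d + 6) * ?L ^ Suc f \<and>
      run inp (let_mult c e g p) (m, out) t (m', out @ xs)"
    using run.Seq[OF 1 run.Seq[OF run.Seq[OF 2 3(3)] 4(3)]] 4(1)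
    unfolding let_mult_def for_loop_def let_in_def agrees_snoc by blast
qed

lemma emits_if:
  assumes e: "evals inp vs e r" and g: "evals inp vs g s"
    and p: "emits inp vs p xs d f" and q: "emits inp vs q ys d' f'"
  shows "emits inp vs (IfLe e g p q) (if r \<le> s then xs else ys) (d + d' + 1) (max f f')"
  unfolding emits_def
proof (intro allI impI)
  fix m out assume m: "agrees m vs"
  let ?L = "Suc (length inp)"
  have v: "expr_val inp m e = r" "expr_val inp m g = s" using e g m by (auto simp: evals_def)
  have 1: "d * ?L ^ f \<le> d * ?L ^ max f f'" "d' * ?L ^ f' \<le> d' * ?L ^ max f f'"
    by (intro mult_le_mono power_increasing; simp)+
  have one: "1 \<le> ?L ^ max f f'" by simp
  show "\<exists>m' t. agrees m' vs \<and> t \<le> (d + d' + 1) * ?L ^ max f f' \<and>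
      run inp (IfLe e g p q) (m, out) t (m', out @ (if r \<le> s then xs else ys))"
  proof (cases "r \<le> s")
    case True
    obtain m' t where 2: "agrees m' vs" "t \<le> d * ?L ^ f" "run inp p (m, out) t (m', out @ xs)"
      using p m unfolding emits_def by blast
    have "Suc t \<le> (d + d' + 1) * ?L ^ max f f'"
      using 1 one 2(2) unfolding distrib_right by linarith
    moreover have "run inp (IfLe e g p q) (m, out) (Suc t) (m', out @ (if r \<le> s then xs else ys))"
      using run.IfTrue[OF _ 2(3)] v True by simp
    ultimately show ?thesis using 2(1) by blast
  next
    case False
    obtain m' t where 2: "agrees m' vs" "t \<le> d' * ?L ^ f'" "run inp q (m, out) t (m', out @ ys)"
      using q m unfolding emits_def by blast
    have "Suc t \<le> (d + d' + 1) * ?L ^ max f f'"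
      using 1 one 2(2) unfolding distrib_right by linarith
    moreover have "run inp (IfLe e g p q) (m, out) (Suc t) (m', out @ (if r \<le> s then xs else ys))"
      using run.IfFalse[OF _ 2(3)] v False by simp
    ultimately show ?thesis using 2(1) by blast
  qed
qed

lemma poly_time_onI:
  assumes "\<And>x. x \<in> X \<Longrightarrow> emits (enc x) [] p (f x) c e"
  shows "poly_time_on X enc f"
  unfolding poly_time_on_def
\<comment> \<open>The polynomial is \<open>c * (1 + X) ^ e\<close>; the empty list of cells puts no
  condition on the initial memory.\<close>
proof (rule exI[of _ p], rule exI[of _ "smult c ([:1, 1:] ^ e)"], rule ballI)
  fix x assume "x \<in> X"
  then obtain m' t where "t \<le> c * Suc (length (enc x)) ^ e"
    "run (enc x) p (\<lambda>_. 0, []) t (m', [] @ f x)"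
    using assms unfolding emits_def agrees_def by fastforce
  then show "\<exists>t m. run (enc x) p (\<lambda>_. 0, []) t (m, f x) \<and>
      t \<le> poly (smult c ([:1, 1:] ^ e)) (length (enc x))"
    by (auto simp: poly_power)
qed


section \<open>Programs for the formulation and for decoding\<close>

lemma concat_concat_map: "concat (map f (concat xss)) = concat (map (\<lambda>xs. concat (map f xs)) xss)"
  by (induction xss) auto

text \<open>\<open>encode_list\<close> without its final 0. In this form it commutes with append and
  concatenation, so each loop can emit its part of a list independently.\<close>

definition encode_items :: "('a \<Rightarrow> real list) \<Rightarrow> 'a list \<Rightarrow> real list" where
  "encode_items enc xs = concat (map (\<lambda>x. 1 # enc x) xs)"

lemma encode_list_items: "encode_list enc xs = encode_items enc xs @ [0]"
  by (simp add: encode_list_def encode_items_def)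

lemma encode_items_simps:
  "encode_items enc [] = []"
  "encode_items enc (x # xs) = 1 # enc x @ encode_items enc xs"
  "encode_items enc (xs @ ys) = encode_items enc xs @ encode_items enc ys"
  "encode_items enc (concat xss) = concat (map (encode_items enc) xss)"
  by (simp_all add: encode_items_def[abs_def] concat_concat_map)

lemma encode_items_map: "encode_items enc (map f xs) = concat (map (\<lambda>i. 1 # enc (f i)) xs)"
  by (simp add: encode_items_def o_def)

definition header :: "program \<Rightarrow> program" where
  "header p = let_in 0 (Input (Const 0)) (let_in 1 (Input (Const 1))
     (let_mult 2 (cell 0) (Minus (Const 1) (Input (Const 2)))
       (let_in 3 (Plus (cell 2) (Input (Const 3))) (let_mult 4 (cell 0) (cell 1) p))))"

text \<open>The memory that \<open>header\<close> sets up in cells 0 to 4; cell 2 is left over from computing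
  the window.\<close>

definition env :: "esg \<Rightarrow> real list" where
  "env G = [real (num_targets G), real (num_sensors G),
     (case recharge G of enat d \<Rightarrow> 0 | \<infinity> \<Rightarrow> real (num_targets G)), real (window G),
     real (num_targets G * num_sensors G)]"

lemma emits_header:
  fixes rest defines "inp G \<equiv> encode_esg G @ rest"
  assumes p: "emits (inp G) (env G) p xs c e"
  shows "emits (inp G) [] (header p) xs (c + 15) (Suc (Suc e))"
proof -
  have l: "4 \<le> length (inp G)" "num_targets G \<le> length (inp G)"
    by (simp_all add: inp_def length_encode_esg)
  have i: "inp G ! 0 = real (num_targets G)" "inp G ! 1 = real (num_sensors G)"
    "inp G ! 2 = (case recharge G of enat d \<Rightarrow> 1 | \<infinity> \<Rightarrow> 0)"
    "inp G ! 3 = (case recharge G of enat d \<Rightarrow> real d | \<infinity> \<Rightarrow> 0)"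
    by (cases "recharge G"; simp add: inp_def encode_esg_eq)+
  have c: "evals (inp G) vs (Const (int a)) (real a)" for vs a
    using evals_const[of _ _ "int a"] by simp
  have rd: "evals (inp G) vs (Input (Const (int a))) (inp G ! a)" if "a < 4" for vs a
    using l that by (intro evals_input[OF c refl]) auto
  let ?n = "real (num_targets G)" let ?k = "real (num_sensors G)"
  \<comment> \<open>Entry 2 is 1 for a finite recharging time and 0 for an infinite one. So
    \<open>?z\<close> is 0 or \<open>n\<close>, and \<open>?w\<close> is the window without a case
    distinction in the program.\<close>
  let ?z = "?n * (1 - inp G ! 2)" let ?w = "?z + inp G ! 3"
  have "env G = [?n, ?k, ?z, ?w, ?n * ?k]"
  proof (cases "recharge G")
    case (enat d)
    then have "inp G ! 2 = 1" "inp G ! 3 = real d" "window G = d" using i by (simp_all add: window_def)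
    then show ?thesis by (simp add: env_def enat)
  next
    case infinity
    then have "inp G ! 2 = 0" "inp G ! 3 = 0" "window G = num_targets G"
      using i by (simp_all add: window_def)
    then show ?thesis by (simp add: env_def infinity)
  qed
  then have p: "emits (inp G) ([?n, ?k, ?z, ?w] @ [?n * ?k]) p xs c e" using p by simp
  have c: "evals (inp G) vs (cell a) r" if "a < length vs" "vs ! a = r" for vs a r
    using evals_cell[OF that(1)] that(2) by simp
  have 4: "emits (inp G) ([?n, ?k, ?z] @ [?w]) (let_mult 4 (cell 0) (cell 1) p) xs (c + 6) (Suc e)"
    by (rule emits_let_mult[OF _ c l(2) c]) (use p in simp_all)
  have 3: "emits (inp G) ([?n, ?k] @ [?z])
      (let_in 3 (Plus (cell 2) (Input (Const 3))) (let_mult 4 (cell 0) (cell 1) p)) xs (Suc (c + 6)) (Suc e)"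
    by (rule emits_let_in[OF _ evals_plus[OF c rd[of 3, simplified]]]) (use 4 in simp_all)
  have 2: "emits (inp G) ([?n] @ [?k]) (let_mult 2 (cell 0) (Minus (Const 1) (Input (Const 2)))
      (let_in 3 (Plus (cell 2) (Input (Const 3))) (let_mult 4 (cell 0) (cell 1) p))) xs
      (Suc (c + 6) + 6) (Suc (Suc e))"
    by (rule emits_let_mult[OF _ c l(2) evals_minus[OF evals_const rd[of 2, simplified]]])
      (use 3 in simp_all)
  have 1: "emits (inp G) ([] @ [?n]) (let_in 1 (Input (Const 1))
      (let_mult 2 (cell 0) (Minus (Const 1) (Input (Const 2)))
      (let_in 3 (Plus (cell 2) (Input (Const 3))) (let_mult 4 (cell 0) (cell 1) p)))) xs
      (Suc (Suc (c + 6) + 6)) (Suc (Suc e))"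
    by (rule emits_let_in[OF _ rd[of 1, simplified]]) (use 2 i in simp_all)
  have "emits (inp G) [] (header p) xs (Suc (Suc (Suc (c + 6) + 6))) (Suc (Suc e))"
    unfolding header_def by (rule emits_let_in[OF _ rd[of 0, simplified]]) (use 1 i in simp_all)
  then show ?thesis by (rule emits_weaken) simp_all
qed

text \<open>The constants spell out the encoding: 1 announces a list element, a term is a
  coefficient, the tag of the variable (0 for \<open>OuterBin\<close>, 2 for
  \<open>InnerBin\<close>) and its index, and 0 closes the linear form before the bound. Inside the
  loops over targets, cell 5 is \<open>i\<close> and cell 6 its row offset.\<close>

definition order_row :: "int \<Rightarrow> program" where
  "order_row s = Seq (emit_list [Const 1]) (Seq
     (for_loop 7 (cell 0) (emit_list [Const 1, Const s, Const 0, Plus (cell 6) (cell 7)]))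
     (emit_list [Const 0, Const s]))"

text \<open>Down a column the row offset changes with every term, so cell 8 is recomputed each time;
  this costs one degree more than a row.\<close>

definition order_column :: program where
  "order_column = Seq (emit_list [Const 1]) (Seq
     (for_loop 7 (cell 0) (let_mult 8 (cell 0) (cell 7)
       (emit_list [Const 1, Const 1, Const 0, Plus (cell 8) (cell 5)])))
     (emit_list [Const 0, Const 1]))"

definition outer_program :: program where
  "outer_program = Seq (for_loop 5 (cell 0) (let_mult 6 (cell 0) (cell 5)
     (Seq (order_row 1) (Seq (order_row (-1)) order_column)))) (emit_list [Const 0])"

definition cover_row :: "int \<Rightarrow> program" where
  "cover_row s = Seq
     (emit_list [Const 1, Const 1, Const s, Const 2, Plus (cell 4) (Plus (cell 4) (cell 5))]) (Seq
     (for_loop 7 (cell 1) (emit_list [Const 1, Const s, Const 2, Plus (cell 6) (cell 7)]))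
     (emit_list [Const 0, Const s]))"

definition sense_program :: program where
  "sense_program = emit_list [Const 1, Const 1, Const 1, Const 2, Plus (cell 6) (cell 7), Const 0,
     Input (Plus (Const 4) (Plus (cell 0) (Plus (cell 6) (cell 7))))]"

text \<open>Cell 6 is the offset of row \<open>i\<close> in a matrix with \<open>k\<close> columns;
  the matrix \<open>x\<close> has \<open>n\<close> columns and gets its own offset in cell
  10.\<close>

definition link_program :: program where
  "link_program = let_mult 9 (cell 1) (cell 8) (let_mult 10 (cell 0) (cell 5)
     (emit_list [Const 1,
        Const 1, Const 1, Const 2, Plus (cell 6) (cell 7),
        Const 1, Const 1, Const 0, Plus (cell 10) (cell 8),
        Const 1, Const (-1), Const 2, Plus (cell 4) (Plus (cell 9) (cell 7)),
        Const 0, Const 1]))"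

definition window_term :: "int \<Rightarrow> program" where
  "window_term s = emit_list [Const 1, Const s, Const 2, Plus (cell 4) (Plus (cell 9) (cell 7))]"

definition window_program :: program where
  "window_program = Seq (emit_list [Const 1]) (Seq
     (for_loop 8 (cell 0) (let_mult 9 (cell 1) (cell 8)
       (IfLe (cell 5) (cell 8)
         (IfLe (cell 8) (Plus (cell 5) (cell 3)) (window_term 1) (window_term 0))
         (window_term 0))))
     (emit_list [Const 0, Const 1]))"

definition inner_program :: program where
  "inner_program = Seq (for_loop 5 (cell 0) (let_mult 6 (cell 1) (cell 5)
     (Seq (Seq (cover_row 1) (cover_row (-1)))
       (for_loop 7 (cell 1) (Seq sense_program (Seq (for_loop 8 (cell 0) link_program) window_program))))))
     (emit_list [Const 0])"

definition objective_program :: program where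
  "objective_program = Seq (for_loop 5 (cell 0) (emit_list [Const 1, Input (Plus (Const 4) (cell 5)),
       Const 2, Plus (cell 4) (Plus (cell 4) (cell 5))]))
     (emit_list [Const 0])"

definition formulation_program :: program where
  "formulation_program = header (Seq (let_mult 5 (cell 0) (cell 0)
       (emit_list [cell 5, Const 0, Plus (cell 4) (Plus (cell 4) (cell 0)), Const 0]))
     (Seq objective_program (Seq outer_program inner_program)))"

text \<open>No sum is formed: a position is printed when a 1 is met, and since a row of a feasible
  matrix has exactly one, each target prints one number.\<close>

definition ordering_program :: program where
  "ordering_program = header (for_loop 5 (cell 0) (let_mult 6 (cell 0) (cell 5)
     (for_loop 7 (cell 0) (IfLe (Const 1)
       (Input (Plus (Const 4) (Plus (cell 0) (Plus (cell 4) (Plus (cell 6) (cell 7))))))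
       (emit_list [Plus (cell 7) (Const 1)]) (emit_list [])))))"

text \<open>The incidences are the first block of inner variables, in the order of
  \<open>encode_plan\<close>, so decoding amounts to copying.\<close>

definition plan_program :: program where
  "plan_program = header (for_loop 5 (cell 0) (let_mult 6 (cell 1) (cell 5)
     (for_loop 7 (cell 1) (emit_list
       [Input (Plus (Const 4) (Plus (cell 0) (Plus (cell 4) (Plus (cell 6) (cell 7)))))]))))"


section \<open>Verification of the programs\<close>

lemma list_all2_ConsI: "P x y \<Longrightarrow> list_all2 P xs ys \<Longrightarrow> list_all2 P (x # xs) (y # ys)"
  by simp

context fixes G :: esg and rest inp :: "real list" defines "inp \<equiv> encode_esg G @ rest" begin

private abbreviation (input) "N \<equiv> num_targets G"
private abbreviation (input) "K \<equiv> num_sensors G"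

lemma emits_for_targets:
  assumes "c = length vs" "0 < c \<and> vs ! 0 = real N"
    "\<And>i. i < N \<Longrightarrow> emits inp (vs @ [real i]) p (xs i) d f"
  shows "emits inp vs (for_loop c (cell 0) p) (concat (map xs [0..<N])) (d + 4) (Suc f)"
  using emits_for_loop[of c vs inp "cell 0" N p xs d f] assms evals_cell[of 0 vs inp]
    n_le[of G rest] unfolding inp_def by simp

lemma emits_for_sensors:
  assumes "0 < N" "c = length vs" "1 < c \<and> vs ! 1 = real K"
    "\<And>i. i < K \<Longrightarrow> emits inp (vs @ [real i]) p (xs i) d f"
  shows "emits inp vs (for_loop c (cell 1) p) (concat (map xs [0..<K])) (d + 4) (Suc f)"
  using emits_for_loop[of c vs inp "cell 1" K p xs d f] assms evals_cell[of 1 vs inp]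
    k_le[of G rest] unfolding inp_def by simp

lemma emits_times_targets:
  assumes "c = length vs" "0 < c \<and> vs ! 0 = real N" "evals inp vs g s"
    "emits inp (vs @ [real N * s]) p xs d f"
  shows "emits inp vs (let_mult c (cell 0) g p) xs (d + 6) (Suc f)"
  using emits_let_mult[of c vs inp "cell 0" N g s p xs d f] assms evals_cell[of 0 vs inp]
    n_le[of G rest] unfolding inp_def by simp

lemma emits_times_sensors:
  assumes "0 < N" "c = length vs" "1 < c \<and> vs ! 1 = real K" "evals inp vs g s"
    "emits inp (vs @ [real K * s]) p xs d f"
  shows "emits inp vs (let_mult c (cell 1) g p) xs (d + 6) (Suc f)"
  using emits_let_mult[of c vs inp "cell 1" K g s p xs d f] assms evals_cell[of 1 vs inp]
    k_le[of G rest] unfolding inp_def by simp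

lemmas emits_intros = emits_emit_list list_all2_ConsI list.rel_intros(1) evals_intros emits_seq emits_if
  emits_for_targets emits_for_sensors emits_times_targets emits_times_sensors

lemmas encode_defs = encode_constraint_def encode_lin_def encode_list_items encode_items_simps
  encode_items_map x_var_def y_var_def z_var_def u_var_def

lemma emits_order_row:
  "emits inp (env G @ [real i, real N * real i]) (order_row s)
     (1 # encode_constraint (map (\<lambda>p. (of_int s, x_var G i p)) [0..<N], of_int s)) 20 1"
  unfolding order_row_def
  apply (rule emits_weaken)
     apply (rule emits_intros | (simp add: env_def; fail))+
  apply (simp_all add: env_def encode_defs algebra_simps)
  done

lemma emits_order_column:
  "emits inp (env G @ [real i, z]) order_column
     (1 # encode_constraint (map (\<lambda>p. (1, x_var G p i)) [0..<N], 1)) 30 2"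
  unfolding order_column_def
  apply (rule emits_weaken)
     apply (rule emits_intros | (simp add: env_def; fail))+
  apply (simp_all add: env_def encode_defs algebra_simps)
  done


lemma emits_outer_program:
  "emits inp (env G) outer_program
     (encode_list encode_constraint (outer_constraints (formulation G))) 100 4"
proof -
  let ?p = "Seq (order_row 1) (Seq (order_row (-1)) order_column)"
  have row: "emits inp (env G @ [real i, real N * real i]) ?p
      (encode_items encode_constraint (order_constraints G i)) 70 2" for i
    apply (rule emits_weaken)
       apply (rule emits_seq emits_order_row emits_order_column)+
      apply (simp_all add: order_constraints_def encode_items_simps)
    done
  have body: "emits inp (env G @ [real i]) (let_mult 6 (cell 0) (cell 5) ?p)
      (encode_items encode_constraint (order_constraints G i)) 76 3" for i
    apply (rule emits_weaken)
       apply (rule emits_times_targets[where s = "real i"])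
          apply (simp add: env_def)
         apply (simp add: env_def)
        using evals_cell[of 5 "env G @ [real i]" inp] apply (simp add: env_def)
       using row[of i] apply simp
      apply simp_all
    done
  show ?thesis
    unfolding outer_program_def
    apply (rule emits_weaken)
       apply (rule body emits_intros | (simp add: env_def; fail))+
      apply (simp_all add: formulation_def encode_list_items encode_items_simps o_def)
    done
qed

lemma emits_cover_row:
  assumes "0 < N"
  shows "emits inp (env G @ [real i, real K * real i]) (cover_row s)
     (1 # encode_constraint ((of_int s, u_var G i) # map (\<lambda>j. (of_int s, y_var G i j)) [0..<K], of_int s)) 30 1"
  unfolding cover_row_def
  apply (rule emits_weaken)
     apply (rule emits_intros assms | (simp add: env_def; fail))+
  apply (simp_all add: env_def encode_defs algebra_simps)
  done

lemma emits_sense_program: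
  assumes "i < N" "j < K"
  shows "emits inp (env G @ [real i, real K * real i, real j]) sense_program
     (1 # encode_constraint (sense_constraint G i j)) 10 0"
proof -
  let ?vs = "env G @ [real i, real K * real i, real j]"
  have q: "4 + N + (i * K + j) < 4 + N + N * K" using flat_index_less[OF assms] by simp
  have "evals inp ?vs (Plus (Const 4) (Plus (cell 0) (Plus (cell 6) (cell 7))))
      (of_int 4 + (?vs ! 0 + (?vs ! 6 + ?vs ! 7)))"
    by (rule evals_intros | (simp add: env_def; fail))+
  then have D: "evals inp ?vs (Input (Plus (Const 4) (Plus (cell 0) (Plus (cell 6) (cell 7)))))
      (of_bool (senses G (Suc i) (Suc j)))"
  proof (rule evals_input)
    show "of_int 4 + (?vs ! 0 + (?vs ! 6 + ?vs ! 7)) = real (4 + N + (i * K + j))"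
      by (simp add: env_def)
    show "4 + N + (i * K + j) < length inp" using q by (simp add: inp_def length_encode_esg)
    show "inp ! (4 + N + (i * K + j)) = of_bool (senses G (Suc i) (Suc j))"
      using inp_esg[OF q, of rest] nth_encode_esg(2)[OF assms] by (simp add: inp_def)
  qed
  show ?thesis
    unfolding sense_program_def
    apply (rule emits_weaken)
       apply (rule D emits_intros | (simp add: env_def; fail))+
    apply (simp_all add: env_def encode_defs sense_constraint_def algebra_simps)
    done
qed

lemma emits_link_program:
  assumes "0 < N"
  shows "emits inp (env G @ [real i, real K * real i, real j, real p]) link_program
     (1 # encode_constraint (link_constraint G i j p)) 40 2"
  unfolding link_program_def
  apply (rule emits_weaken)
     apply (rule emits_intros assms | (simp add: env_def; fail))+
  apply (simp_all add: env_def encode_defs link_constraint_def algebra_simps)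
  done

lemma emits_window_program:
  assumes "0 < N"
  shows "emits inp (env G @ [real i, z, real j]) window_program
     (1 # encode_constraint (window_constraint G i j)) 60 2"
  unfolding window_program_def window_term_def
  apply (rule emits_weaken)
     apply (rule emits_intros assms | (simp add: env_def; fail))+
  apply (simp_all add: env_def encode_defs window_constraint_def algebra_simps cong: if_cong)
  \<comment> \<open>The program compares reals, the constraint natural numbers; equality is settled
    position by position.\<close>
  apply (intro arg_cong[of _ _ concat] map_cong refl)
  apply auto
  done

lemma emits_inner_program:
  "emits inp (env G) inner_program
     (encode_list encode_constraint (inner_constraints (formulation G))) 300 6"
proof -
  let ?q = "Seq sense_program (Seq (for_loop 8 (cell 0) link_program) window_program)"
  let ?xs = "\<lambda>i j. encode_items encode_constraint (sense_constraint G i j #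
      map (link_constraint G i j) [0..<N] @ [window_constraint G i j])"
  let ?ys = "\<lambda>i. encode_items encode_constraint (cover_constraints G i) @ concat (map (?xs i) [0..<K])"
  let ?p = "Seq (Seq (cover_row 1) (cover_row (-1))) (for_loop 7 (cell 1) ?q)"
  have q: "emits inp ((env G @ [real i, real K * real i]) @ [real j]) ?q (?xs i j) 150 3"
    if "i < N" "j < K" for i j
  proof -
    have n: "0 < N" using that by simp
    have l: "emits inp ((env G @ [real i, real K * real i, real j]) @ [real p]) link_program
      (1 # encode_constraint (link_constraint G i j p)) 40 2" for p
      using emits_link_program[OF n, of i j p] by simp
    have "emits inp (env G @ [real i, real K * real i, real j]) ?q (?xs i j) 150 3"
      apply (rule emits_weaken)
         apply (rule emits_sense_program[OF that] emits_window_program[OF n] l emits_seq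
          emits_for_targets | (simp add: env_def; fail))+
        apply (simp_all add: encode_items_simps encode_items_map)
      done
    then show ?thesis by simp
  qed
  have p: "emits inp (env G @ [real i, real K * real i]) ?p (?ys i) 250 4" if "i < N" for i
  proof -
    have n: "0 < N" using that by simp
    show ?thesis
      apply (rule emits_weaken)
         apply (rule emits_cover_row[OF n] q[OF that] emits_seq
          emits_for_sensors n | assumption | (simp add: env_def; fail))+
        apply (simp_all add: encode_items_simps cover_constraints_def)
      done
  qed
  have body: "emits inp (env G @ [real i]) (let_mult 6 (cell 1) (cell 5) ?p) (?ys i) 260 5"
    if "i < N" for i
    apply (rule emits_weaken)
       apply (rule emits_times_sensors[where s = "real i"])
           using that apply simp
          apply (simp add: env_def)
         apply (simp add: env_def)
        using evals_cell[of 5 "env G @ [real i]" inp] apply (simp add: env_def)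
       using p[OF that] apply simp
      apply simp_all
    done
  show ?thesis
    unfolding inner_program_def
    apply (rule emits_weaken)
       apply (rule body emits_intros | assumption | (simp add: env_def; fail))+
      apply (simp_all add: formulation_def encode_list_items encode_items_simps o_def)
    done
qed

lemma emits_objective_program:
  "emits inp (env G) objective_program (encode_lin (objective (formulation G))) 20 1"
proof -
  have v: "evals inp (env G @ [real i]) (Input (Plus (Const 4) (cell 5))) (target_val G (Suc i))"
    if i: "i < N" for i
  proof (rule evals_input)
    show "evals inp (env G @ [real i]) (Plus (Const 4) (cell 5)) (of_int 4 + (env G @ [real i]) ! 5)"
      by (rule evals_intros | (simp add: env_def; fail))+
    show "of_int 4 + (env G @ [real i]) ! 5 = real (4 + i)" by (simp add: env_def)
    show "4 + i < length inp" using i by (simp add: inp_def length_encode_esg)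
    show "inp ! (4 + i) = target_val G (Suc i)"
      using inp_esg[of "4 + i" G rest] nth_encode_esg(1)[OF i] i by (simp add: inp_def)
  qed
  show ?thesis
    unfolding objective_program_def
    apply (rule emits_weaken)
       apply (rule v emits_intros | assumption | (simp add: env_def; fail))+
      apply (simp_all add: env_def encode_defs formulation_def mult.commute)
    done
qed

lemma emits_formulation_program:
  "emits inp [] formulation_program (encode_bilevel (formulation G)) 500 8"
proof -
  have "emits inp (env G) (Seq (let_mult 5 (cell 0) (cell 0)
       (emit_list [cell 5, Const 0, Plus (cell 4) (Plus (cell 4) (cell 0)), Const 0]))
     (Seq objective_program (Seq outer_program inner_program))) (encode_bilevel (formulation G)) 480 6"
    apply (rule emits_weaken)
       apply (rule emits_objective_program emits_outer_program emits_inner_program emits_intros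
        | (simp add: env_def; fail))+
      apply (simp_all add: env_def encode_bilevel_def)
      apply (simp_all add: formulation_def)
    done
  from emits_header[OF this[unfolded inp_def]] show ?thesis
    unfolding formulation_program_def inp_def by (rule emits_weaken) simp_all
qed

text \<open>The stride \<open>b\<close> is the number of columns: \<open>n\<close> when an ordering
  is decoded, \<open>k\<close> for a plan. Cells 0 and 4 skip the target values and the sensing
  matrix.\<close>

lemma evals_assignment:
  assumes "i < N" "j < b" "N * b \<le> length rest"
  shows "evals inp (env G @ [real i, real b * real i, real j])
    (Input (Plus (Const 4) (Plus (cell 0) (Plus (cell 4) (Plus (cell 6) (cell 7)))))) (rest ! (i * b + j))"
proof (rule evals_input)
  let ?vs = "env G @ [real i, real b * real i, real j]"
  show "evals inp ?vs (Plus (Const 4) (Plus (cell 0) (Plus (cell 4) (Plus (cell 6) (cell 7)))))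
      (of_int 4 + (?vs ! 0 + (?vs ! 4 + (?vs ! 6 + ?vs ! 7))))"
    by (rule evals_intros | (simp add: env_def; fail))+
  show "of_int 4 + (?vs ! 0 + (?vs ! 4 + (?vs ! 6 + ?vs ! 7))) = real (4 + N + N * K + (i * b + j))"
    by (simp add: env_def)
  show "4 + N + N * K + (i * b + j) < length inp"
    using flat_index_less[OF assms(1,2)] assms(3) by (simp add: inp_def length_encode_esg)
  show "inp ! (4 + N + N * K + (i * b + j)) = rest ! (i * b + j)"
    using inp_rest[of G rest] by (simp add: inp_def)
qed

lemma emits_plan_program:
  assumes "N * K \<le> length rest"
  shows "emits inp [] plan_program (concat (map (\<lambda>i. map (\<lambda>j. rest ! (i * K + j)) [0..<K]) [0..<N])) 60 6"
proof -
  let ?e = "Input (Plus (Const 4) (Plus (cell 0) (Plus (cell 4) (Plus (cell 6) (cell 7)))))"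
  have p: "emits inp (env G @ [real i, real K * real i]) (for_loop 7 (cell 1) (emit_list [?e]))
      (map (\<lambda>j. rest ! (i * K + j)) [0..<K]) 20 1" if "i < N" for i
  proof -
    have e: "evals inp ((env G @ [real i, real K * real i]) @ [real j]) ?e (rest ! (i * K + j))"
      if "j < K" for j
      using evals_assignment[OF \<open>i < N\<close> that assms] by simp
    have n: "0 < N" using that by simp
    show ?thesis
      apply (rule emits_weaken)
         apply (rule e n emits_intros | assumption | (simp add: env_def; fail))+
      done
  qed
  have body: "emits inp (env G @ [real i]) (let_mult 6 (cell 1) (cell 5)
        (for_loop 7 (cell 1) (emit_list [?e]))) (map (\<lambda>j. rest ! (i * K + j)) [0..<K]) 30 2"
    if "i < N" for i
    apply (rule emits_weaken)
       apply (rule emits_times_sensors[where s = "real i"])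
           using that apply simp
          apply (simp add: env_def)
         apply (simp add: env_def)
        using evals_cell[of 5 "env G @ [real i]" inp] apply (simp add: env_def)
       using p[OF that] apply simp
      apply simp_all
    done
  have "emits inp (env G) (for_loop 5 (cell 0) (let_mult 6 (cell 1) (cell 5)
        (for_loop 7 (cell 1) (emit_list [?e]))))
      (concat (map (\<lambda>i. map (\<lambda>j. rest ! (i * K + j)) [0..<K]) [0..<N])) 40 3"
    apply (rule emits_weaken)
       apply (rule emits_for_targets)
         apply (simp add: env_def)
        apply (simp add: env_def)
       apply (erule body)
      apply simp_all
    done
  from emits_header[OF this[unfolded inp_def]] show ?thesis
    unfolding plan_program_def inp_def by (rule emits_weaken) simp_all
qed

lemma emits_ordering_program:
  assumes "N * N \<le> length rest" and s: "\<And>i. i < N \<Longrightarrow> s i < N"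
    "\<And>i p. i < N \<Longrightarrow> p < N \<Longrightarrow> rest ! (i * N + p) = of_bool (p = s i)"
  shows "emits inp [] ordering_program (map (\<lambda>i. real (Suc (s i))) [0..<N]) 80 7"
proof -
  let ?e = "Input (Plus (Const 4) (Plus (cell 0) (Plus (cell 4) (Plus (cell 6) (cell 7)))))"
  let ?p = "for_loop 7 (cell 0) (IfLe (Const 1) ?e (emit_list [Plus (cell 7) (Const 1)]) (emit_list []))"
  have p: "emits inp (env G @ [real i, real N * real i]) ?p [real (Suc (s i))] 20 1" if "i < N" for i
  proof -
    have e: "evals inp ((env G @ [real i, real N * real i]) @ [real q]) ?e (of_bool (q = s i))"
      if "q < N" for q
      using evals_assignment[OF \<open>i < N\<close> that assms(1)] s(2)[OF \<open>i < N\<close> that] by simp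
    have [simp]: "1 \<le> (of_bool P :: real) \<longleftrightarrow> P" for P by simp
    have "emits inp (env G @ [real i, real N * real i]) ?p
        (concat (map (\<lambda>q. if q = s i then [real (Suc q)] else []) [0..<N])) 20 1"
      apply (rule emits_weaken)
         apply (rule e emits_intros | assumption | (simp add: env_def; fail))+
        apply (simp_all add: env_def add.commute cong: if_cong)
      done
    moreover have "concat (map (\<lambda>q. if q = a then [real (Suc q)] else []) [0..<b]) =
        (if a < b then [real (Suc a)] else [])" for a b
      by (induction b) auto
    ultimately show ?thesis using s(1)[OF that] by simp
  qed
  have body: "emits inp (env G @ [real i]) (let_mult 6 (cell 0) (cell 5) ?p) [real (Suc (s i))] 30 2"
    if "i < N" for i
    apply (rule emits_weaken)
       apply (rule emits_times_targets[where s = "real i"])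
          apply (simp add: env_def)
         apply (simp add: env_def)
        using evals_cell[of 5 "env G @ [real i]" inp] apply (simp add: env_def)
       using p[OF that] apply simp
      apply simp_all
    done
  have "emits inp (env G) (for_loop 5 (cell 0) (let_mult 6 (cell 0) (cell 5) ?p))
      (map (\<lambda>i. real (Suc (s i))) [0..<N]) 40 3"
    apply (rule emits_weaken)
       apply (rule emits_for_targets)
         apply (simp add: env_def)
        apply (simp add: env_def)
       apply (erule body)
      apply simp_all
    done
  from emits_header[OF this[unfolded inp_def]] show ?thesis
    unfolding ordering_program_def inp_def by (rule emits_weaken) simp_all
qed

end

section \<open>Polynomial time of construction and decoding\<close>

lemma poly_time_formulation_formulation:
  "poly_time_formulation formulation decode_ordering decode_plan"
  unfolding poly_time_formulation_def
proof (intro conjI)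
  show "poly_time_on {G. is_esg G} encode_esg (\<lambda>G. encode_bilevel (formulation G))"
    using emits_formulation_program[of _ "[]"] by (intro poly_time_onI) simp
  show "poly_time_on {(G, x). is_esg G \<and> x \<in> outer_feasible (formulation G)}
      (\<lambda>(G, x). encode_esg G @ encode_assignment (outer_var_list (formulation G)) x)
      (\<lambda>(G, x). encode_ordering G (decode_ordering G x))"
  proof (rule poly_time_onI, clarify)
    fix G x assume x: "x \<in> outer_feasible (formulation G)"
    let ?rest = "encode_assignment (outer_var_list (formulation G)) x"
    let ?n = "num_targets G"
    obtain s where s: "bij_betw s {..<?n} {..<?n}"
      "\<And>i p. i < ?n \<Longrightarrow> p < ?n \<Longrightarrow> x (x_var G i p) = of_bool (p = s i)"
      "\<And>i. i < ?n \<Longrightarrow> decode_ordering G x (Suc i) = Suc (s i)"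
      using outer_feasibleE[OF x] by metis
    have rest: "?rest = map (\<lambda>q. real_of_int (x (OuterBin q))) [0..<?n * ?n]"
      by (simp add: encode_assignment_def outer_var_list_def formulation_def)
    have "emits (encode_esg G @ ?rest) [] ordering_program
        (map (\<lambda>i. real (Suc (s i))) [0..<?n]) 80 7"
    proof (rule emits_ordering_program)
      show "s i < ?n" if "i < ?n" for i using s(1) that by (auto simp: bij_betw_def)
      show "?rest ! (i * ?n + p) = of_bool (p = s i)" if "i < ?n" "p < ?n" for i p
        using s(2)[OF that] flat_index_less[OF that] by (simp add: rest x_var_def)
    qed (simp add: rest)
    moreover have "map (\<lambda>i. real (Suc (s i))) [0..<?n] = encode_ordering G (decode_ordering G x)"
      using s(3) by (simp add: encode_ordering_eq)
    ultimately show "emits (encode_esg G @ ?rest) [] ordering_program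
        (encode_ordering G (decode_ordering G x)) 80 7" by simp
  qed
  show "poly_time_on {(G, y). is_esg G \<and> (\<exists>x\<in>outer_feasible (formulation G). y \<in> inner_feasible (formulation G) x)}
      (\<lambda>(G, y). encode_esg G @ encode_assignment (inner_var_list (formulation G)) y)
      (\<lambda>(G, y). encode_plan G (decode_plan G y))"
  proof (rule poly_time_onI, clarify)
    fix G x y assume y: "y \<in> inner_feasible (formulation G) x"
    let ?rest = "encode_assignment (inner_var_list (formulation G)) y"
    let ?n = "num_targets G" let ?k = "num_sensors G"
    have rest: "?rest = map (\<lambda>q. real_of_int (y (InnerBin q))) [0..<2 * (?n * ?k) + ?n]"
      by (simp add: encode_assignment_def inner_var_list_def formulation_def)
    have "?rest ! (i * ?k + j) = of_bool (Suc i \<in> decode_plan G y (Suc j))"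
      if "i < ?n" "j < ?k" for i j
    proof -
      have "?rest ! (i * ?k + j) = real_of_int (y (y_var G i j))"
        using flat_index_less[OF that] by (simp add: rest y_var_def)
      \<comment> \<open>Feasibility restricts the entry to 0 and 1, so the copied number is the
        indicator that \<open>encode_plan\<close> asks for.\<close>
      then show ?thesis
        using inner_feasible_range(1)[OF y that] that by (auto simp: decode_plan_iff)
    qed
    then have "concat (map (\<lambda>i. map (\<lambda>j. ?rest ! (i * ?k + j)) [0..<?k]) [0..<?n]) =
        encode_plan G (decode_plan G y)"
      unfolding encode_plan_eq by (intro arg_cong[of _ _ concat] map_cong refl) simp
    then show "emits (encode_esg G @ ?rest) [] plan_program (encode_plan G (decode_plan G y)) 60 6"
      using emits_plan_program[of G ?rest] by (simp add: rest)
  qed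
qed

theorem proposition5:
  shows "\<exists>(P :: esg \<Rightarrow> bilevel)
      (dec_ord :: esg \<Rightarrow> (var \<Rightarrow> int) \<Rightarrow> nat \<Rightarrow> nat)
      (dec_plan :: esg \<Rightarrow> (var \<Rightarrow> int) \<Rightarrow> nat \<Rightarrow> nat set)
      (C :: nat).
    poly_time_formulation P dec_ord dec_plan \<and>
    (\<forall>G. is_esg G \<longrightarrow> bilevel_formulation G (P G) (dec_ord G) (dec_plan G)) \<and>
    (\<forall>G n k. is_esg G \<longrightarrow> num_targets G = n \<longrightarrow> num_sensors G = k \<longrightarrow> 1 \<le> n \<longrightarrow> 1 \<le> k \<longrightarrow>
       num_binary_vars (P G) \<le> C * (n\<^sup>2 + n * k) \<and>
       num_integer_vars (P G) \<le> C * n \<and>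
       num_constraints (P G) \<le> C * (n\<^sup>2 * k))"
proof (intro exI conjI)
  show "poly_time_formulation formulation decode_ordering decode_plan"
    by (rule poly_time_formulation_formulation)
  show "\<forall>G. is_esg G \<longrightarrow> bilevel_formulation G (formulation G) (decode_ordering G) (decode_plan G)"
    using bilevel_formulation_formulation by blast
  show "\<forall>G n k. is_esg G \<longrightarrow> num_targets G = n \<longrightarrow> num_sensors G = k \<longrightarrow> 1 \<le> n \<longrightarrow> 1 \<le> k \<longrightarrow>
       num_binary_vars (formulation G) \<le> 8 * (n\<^sup>2 + n * k) \<and>
       num_integer_vars (formulation G) \<le> 8 * n \<and>
       num_constraints (formulation G) \<le> 8 * (n\<^sup>2 * k)"
    using formulation_size by blast
qed

end
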